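(* Let $a,b\in[1/2,1]$ be any numbers satisfying $2b+a=2$. For every $\epsilon>0$ there exists a quantum protocol for weak oblivious transfer with $P^{\star}_{\mathrm{Alice}} \leq a+\epsilon/2$ and $P^{\star}_{\mathrm{Bob}}\leq b+\epsilon/4$, so that $2P^{\star}_{\mathrm{Bob}}+P^{\star}_{\mathrm{Alice}}\leq 2+\epsilon$.
   Context: Oblivious transfer is a two-party task in which Alice has a choice bit $a\in\{0,1\}$ and Bob has two data bits $x_0,x_1\in\{0,1\}$. A quantum protocol for oblivious transfer is an interactive quantum protocol between Alice and Bob that is complete: if both parties follow it honestly, neither party aborts and at the end Alice learns $x_a$ with certainty. Honest parties' inputs are taken uniformly at random. For a given protocol, $P^{\star}_{\mathrm{Bob}}$ denotes the maximum, over all cheating strategies of Bob, of the probability that Bob correctly guesses honest Alice's uniformly random choice bit and honest Alice does not abort. $P^{\star}_{\mathrm{Alice}}$ denotes the maximum over the choice index $c\in\{0,1\}$ of the maximum, over all cheating strategies of Alice that let her guess $x_c$ with certainty, of the probability that she correctly guesses $x_{1-c}$ and honest Bob (with uniformly random $x_0,x_1$) does not abort. "Weak oblivious transfer" refers to this definition of $P^{\star}_{\mathrm{Alice}}$. *)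

theory Defs
  imports Complex_Main "Jordan_Normal_Form.Matrix"
begin

text \<open>Conjugate transpose, inner product, Kronecker (tensor) products.
  Tensor index convention: basis index of A \<otimes> B is i * dim B + j.\<close>

definition adj :: "complex mat \<Rightarrow> complex mat" where
  "adj A = mat (dim_col A) (dim_row A) (\<lambda>(i,j). cnj (A $$ (j,i)))"

definition cinner :: "complex vec \<Rightarrow> complex vec \<Rightarrow> complex" where
  "cinner u v = (\<Sum>i<dim_vec u. cnj (u $ i) * v $ i)"

definition kron :: "complex mat \<Rightarrow> complex mat \<Rightarrow> complex mat" where
  "kron A B = mat (dim_row A * dim_row B) (dim_col A * dim_col B)
     (\<lambda>(i,j). A $$ (i div dim_row B, j div dim_col B) * B $$ (i mod dim_row B, j mod dim_col B))"

definition vkron :: "complex vec \<Rightarrow> complex vec \<Rightarrow> complex vec" where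
  "vkron u v = vec (dim_vec u * dim_vec v) (\<lambda>i. u $ (i div dim_vec v) * v $ (i mod dim_vec v))"

definition unit_state :: "nat \<Rightarrow> complex vec \<Rightarrow> bool" where
  "unit_state d v \<longleftrightarrow> dim_vec v = d \<and> cinner v v = 1"

definition unitary_on :: "nat \<Rightarrow> complex mat \<Rightarrow> bool" where
  "unitary_on d U \<longleftrightarrow> U \<in> carrier_mat d d \<and> U * adj U = 1\<^sub>m d \<and> adj U * U = 1\<^sub>m d"

definition psd_on :: "nat \<Rightarrow> complex mat \<Rightarrow> bool" where
  "psd_on d E \<longleftrightarrow> E \<in> carrier_mat d d \<and> adj E = E \<and>
     (\<forall>v. dim_vec v = d \<longrightarrow> Im (cinner v (E *\<^sub>v v)) = 0 \<and> Re (cinner v (E *\<^sub>v v)) \<ge> 0)"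

definition povm_on :: "nat \<Rightarrow> ('o::finite \<Rightarrow> complex mat) \<Rightarrow> bool" where
  "povm_on d E \<longleftrightarrow> (\<forall>k. psd_on d (E k)) \<and> (\<forall>i<d. \<forall>j<d. (\<Sum>k\<in>UNIV. E k $$ (i,j)) = (if i = j then 1 else 0))"

definition prob :: "complex vec \<Rightarrow> complex mat \<Rightarrow> real" where
  "prob psi E = Re (cinner psi (E *\<^sub>v psi))"

text \<open>Joint probability that Alice's measurement EA (on her register A) and Bob's
  measurement EB (on registers M \<otimes> B) give outcomes (k, r) with P k r, on a state of A \<otimes> M \<otimes> B.\<close>
definition jprob :: "complex vec \<Rightarrow> ('o::finite \<Rightarrow> complex mat) \<Rightarrow> ('r::finite \<Rightarrow> complex mat)
    \<Rightarrow> ('o \<Rightarrow> 'r \<Rightarrow> bool) \<Rightarrow> real" where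
  "jprob psi EA EB P = (\<Sum>k\<in>UNIV. \<Sum>r\<in>UNIV. if P k r then prob psi (kron (EA k) (EB r)) else 0)"

text \<open>Registers: Alice's private register A (dimension dA), message register M (dimension dM),
  Bob's private register B (dimension dB); global state lives on A \<otimes> M \<otimes> B.
  Alice prepares a state on A \<otimes> M and sends M.  Then for j < n: Bob applies a unitary
  VB j on M \<otimes> B and sends M back; Alice applies a unitary UA j on A \<otimes> M and sends M.
  At the end Alice measures A and Bob measures M \<otimes> B.\<close>
fun exec :: "nat \<Rightarrow> nat \<Rightarrow> nat \<Rightarrow> complex vec \<Rightarrow> complex vec
    \<Rightarrow> (nat \<Rightarrow> complex mat) \<Rightarrow> (nat \<Rightarrow> complex mat) \<Rightarrow> nat \<Rightarrow> complex vec" where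
  "exec dA dM dB psiA phiB UA VB 0 = vkron psiA phiB"
| "exec dA dM dB psiA phiB UA VB (Suc j) =
     kron (UA j) (1\<^sub>m dB) *\<^sub>v (kron (1\<^sub>m dA) (VB j) *\<^sub>v exec dA dM dB psiA phiB UA VB j)"

text \<open>A quantum oblivious transfer protocol: Alice's actions depend on her choice bit a,
  Bob's on his data bits (x0, x1).  Alice's final measurement has outcomes Some y (output y)
  or None (abort); Bob's has outcomes True (accept) or False (abort).\<close>
record ot_protocol =
  dA :: nat
  dM :: nat
  dB :: nat
  rounds :: nat
  aInit :: "bool \<Rightarrow> complex vec"
  aUnit :: "nat \<Rightarrow> bool \<Rightarrow> complex mat"
  aMeas :: "bool \<Rightarrow> bool option \<Rightarrow> complex mat"
  bInit :: "bool \<Rightarrow> bool \<Rightarrow> complex vec"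
  bUnit :: "nat \<Rightarrow> bool \<Rightarrow> bool \<Rightarrow> complex mat"
  bMeas :: "bool \<Rightarrow> bool \<Rightarrow> bool \<Rightarrow> complex mat"

definition sel :: "bool \<Rightarrow> bool \<Rightarrow> bool \<Rightarrow> bool" where
  "sel c x0 x1 = (if c then x1 else x0)"

definition honest_run :: "ot_protocol \<Rightarrow> bool \<Rightarrow> bool \<Rightarrow> bool \<Rightarrow> complex vec" where
  "honest_run P a x0 x1 = exec (dA P) (dM P) (dB P) (aInit P a) (bInit P x0 x1)
     (\<lambda>j. aUnit P j a) (\<lambda>j. bUnit P j x0 x1) (rounds P)"

definition valid_ot_protocol :: "ot_protocol \<Rightarrow> bool" where
  "valid_ot_protocol P \<longleftrightarrow>
     (\<forall>a. unit_state (dA P * dM P) (aInit P a)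
        \<and> (\<forall>j < rounds P. unitary_on (dA P * dM P) (aUnit P j a))
        \<and> povm_on (dA P) (aMeas P a))
   \<and> (\<forall>x0 x1. unit_state (dB P) (bInit P x0 x1)
        \<and> (\<forall>j < rounds P. unitary_on (dM P * dB P) (bUnit P j x0 x1))
        \<and> povm_on (dM P * dB P) (bMeas P x0 x1))
   \<and> (\<forall>a x0 x1. jprob (honest_run P a x0 x1) (aMeas P a) (bMeas P x0 x1)
                  (\<lambda>k r. k = Some (sel a x0 x1) \<and> r) = 1)"

text \<open>A cheating Bob: arbitrary private dimension d, initial state on his register,
  arbitrary unitaries on M \<otimes> B', final two-outcome measurement (his guess of a) on M \<otimes> B'.\<close>
definition cheat_bob_ok :: "ot_protocol \<Rightarrow> nat \<Rightarrow> complex vec \<Rightarrow> (nat \<Rightarrow> complex mat)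
    \<Rightarrow> (bool \<Rightarrow> complex mat) \<Rightarrow> bool" where
  "cheat_bob_ok P d phi V F \<longleftrightarrow> unit_state d phi
     \<and> (\<forall>j < rounds P. unitary_on (dM P * d) (V j)) \<and> povm_on (dM P * d) F"

definition bob_cheat_prob :: "ot_protocol \<Rightarrow> nat \<Rightarrow> complex vec \<Rightarrow> (nat \<Rightarrow> complex mat)
    \<Rightarrow> (bool \<Rightarrow> complex mat) \<Rightarrow> real" where
  "bob_cheat_prob P d phi V F = (1/2) * (\<Sum>a\<in>UNIV.
     jprob (exec (dA P) (dM P) d (aInit P a) phi (\<lambda>j. aUnit P j a) V (rounds P))
       (aMeas P a) F (\<lambda>k g. k \<noteq> None \<and> g = a))"

definition P_Bob_star :: "ot_protocol \<Rightarrow> real" where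
  "P_Bob_star P = Sup {bob_cheat_prob P d phi V F | d phi V F. cheat_bob_ok P d phi V F}"

text \<open>A cheating Alice: arbitrary private dimension d, initial state on A' \<otimes> M, arbitrary
  unitaries on A' \<otimes> M, final measurement on A' with outcome a guess (g0, g1) of (x0, x1).\<close>
definition cheat_alice_ok :: "ot_protocol \<Rightarrow> nat \<Rightarrow> complex vec \<Rightarrow> (nat \<Rightarrow> complex mat)
    \<Rightarrow> (bool \<times> bool \<Rightarrow> complex mat) \<Rightarrow> bool" where
  "cheat_alice_ok P d psi U G \<longleftrightarrow> unit_state (d * dM P) psi
     \<and> (\<forall>j < rounds P. unitary_on (d * dM P) (U j)) \<and> povm_on d G"

definition alice_run :: "ot_protocol \<Rightarrow> nat \<Rightarrow> complex vec \<Rightarrow> (nat \<Rightarrow> complex mat)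
    \<Rightarrow> bool \<Rightarrow> bool \<Rightarrow> complex vec" where
  "alice_run P d psi U x0 x1 = exec d (dM P) (dB P) psi (bInit P x0 x1) U
     (\<lambda>j. bUnit P j x0 x1) (rounds P)"

definition alice_certain :: "ot_protocol \<Rightarrow> bool \<Rightarrow> nat \<Rightarrow> complex vec \<Rightarrow> (nat \<Rightarrow> complex mat)
    \<Rightarrow> (bool \<times> bool \<Rightarrow> complex mat) \<Rightarrow> bool" where
  "alice_certain P c d psi U G \<longleftrightarrow> (\<forall>x0 x1.
     jprob (alice_run P d psi U x0 x1) G (bMeas P x0 x1)
       (\<lambda>g r. sel c (fst g) (snd g) = sel c x0 x1) = 1)"

definition alice_cheat_prob :: "ot_protocol \<Rightarrow> bool \<Rightarrow> nat \<Rightarrow> complex vec \<Rightarrow> (nat \<Rightarrow> complex mat)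
    \<Rightarrow> (bool \<times> bool \<Rightarrow> complex mat) \<Rightarrow> real" where
  "alice_cheat_prob P c d psi U G = (1/4) * (\<Sum>x0\<in>UNIV. \<Sum>x1\<in>UNIV.
     jprob (alice_run P d psi U x0 x1) G (bMeas P x0 x1)
       (\<lambda>g r. sel (\<not> c) (fst g) (snd g) = sel (\<not> c) x0 x1 \<and> r))"

definition P_Alice_star :: "ot_protocol \<Rightarrow> real" where
  "P_Alice_star P = Max ((\<lambda>c. Sup {alice_cheat_prob P c d psi U G | d psi U G.
      cheat_alice_ok P d psi U G \<and> alice_certain P c d psi U G}) ` UNIV)"

end

theory Submission
  imports Defs
begin

text \<open>Mixing two perfect protocols, one where Bob reveals both bits (Alice wins) and one where he only
  multiplies phases \<open>(-1)\<^bsup>x\<^sub>0\<^esup>\<close>, \<open>(-1)\<^bsup>x\<^sub>1\<^esup>\<close>, 1 onto \<open>|0\<rangle>\<close>, \<open>|1\<rangle>\<close>, \<open>|2\<rangle>\<close>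
  (Bob wins), with weights \<open>q\<close> and \<open>1 - q\<close> gives any point on the line \<open>2b + a = 2\<close>, provided that Alice
  cannot choose the weights. No coin flipping is needed for this, because a cheating Alice must learn \<open>x\<^sub>c\<close> with
  certainty: the states that she may receive for different \<open>x\<^sub>c\<close> are then exactly orthogonal. As Bob's
  operations are diagonal, each of these orthogonality relations is a linear equation in the weights of
  the basis states she sent. Bob adds, with probability \<open>\<eta>\<close>, a branch whose phases make this
  equation say that the revealing block has weight \<open>q\<close>; it costs at most \<open>\<eta>\<close> in Alice's winning
  probability. In the other branches a hidden random sign between the two blocks destroys their coherence.
  Bob's view of honest Alice is a classical distribution on basis states, which bounds his guess.\<close>

section \<open>Inner products and positive operators\<close>

text \<open>The constants come from the two perfect protocols being mixed. As bounds on the pair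
  (Alice, Bob), revealing both bits gives (1, 1/2) and the qutrit gives (1/2, 3/4), so weight
  \<open>q\<close> gives ((1 + q)/2, (3 - q)/4), and \<open>q = 2 * a - 1\<close>. The obstacle is
  that a cheating Alice would put all her weight on the revealing block. Certainty has no tolerance:
  a branch of any positive probability imposes its equation exactly. So the parameter
  \<open>\<eta>\<close> may be arbitrarily small while the constraint on her weights stays sharp.
  The price appears only on Alice's side, as \<open>\<eta>\<close> times 1 - a; Bob's bound is
  exactly b, because it depends only on the distribution of the basis state that Alice sends and not
  on the phases prescribed to honest Bob. The hidden sign has a second use: comparing both signs
  splits each orthogonality relation into one for the qutrit block and one for the revealing block.
  The former forces Alice's weight on the basis state carrying the other bit to be zero.\<close>

lemma sum_lessThan_mult:
  fixes f :: "nat \<Rightarrow> 'a::comm_monoid_add"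
  shows "(\<Sum>k<m*n. f k) = (\<Sum>i<m. \<Sum>j<n. f (i*n+j))"
proof (induction m)
  case (Suc m)
  have "{..<Suc m * n} = {..<m*n} \<union> {m*n..<m*n+n}" "{..<m*n} \<inter> {m*n..<m*n+n} = {}" by auto
  then have "(\<Sum>k<Suc m * n. f k) = (\<Sum>k<m*n. f k) + (\<Sum>k=m*n..<m*n+n. f k)"
    by (simp only: sum.union_disjoint[OF finite_lessThan finite_atLeastLessThan])
  also have "(\<Sum>k=m*n..<m*n+n. f k) = (\<Sum>j<n. f (m*n+j))"
    using sum.shift_bounds_nat_ivl[of f 0 "m*n" n] by (simp add: lessThan_atLeast0 add.commute)
  finally show ?case using Suc by simp
qed simp

lemma mult_add_less:
  fixes i j m n :: nat
  assumes "i < m" "j < n"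
  shows "i*n+j < m*n"
proof -
  have "i*n+j < i*n+n" using assms by simp
  also have "\<dots> = Suc i * n" by simp
  also have "\<dots> \<le> m*n" using assms(1) by (intro mult_right_mono) auto
  finally show ?thesis .
qed

lemma div_less_mult: "(k::nat) < m * n \<Longrightarrow> k div n < m"
  by (simp add: less_mult_imp_div_less)

lemma mod_less_mult: "(k::nat) < m * n \<Longrightarrow> k mod n < n"
  by (metis mod_less_divisor mult_0_right not_gr_zero not_less_zero)

lemma cinner_add_right: "dim_vec u = d \<Longrightarrow> dim_vec v = d \<Longrightarrow> dim_vec w = d \<Longrightarrow> cinner u (v + w) = cinner u v + cinner u w"
  by (simp add: cinner_def sum.distrib algebra_simps)

lemma cinner_add_left: "dim_vec u = d \<Longrightarrow> dim_vec v = d \<Longrightarrow> dim_vec w = d \<Longrightarrow> cinner (u + v) w = cinner u w + cinner v w"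
  by (simp add: cinner_def sum.distrib algebra_simps)

lemma cinner_diff_right: "dim_vec u = d \<Longrightarrow> dim_vec v = d \<Longrightarrow> dim_vec w = d \<Longrightarrow> cinner u (v - w) = cinner u v - cinner u w"
  by (simp add: cinner_def sum_subtractf algebra_simps)

lemma cinner_diff_left: "dim_vec u = d \<Longrightarrow> dim_vec v = d \<Longrightarrow> dim_vec w = d \<Longrightarrow> cinner (u - v) w = cinner u w - cinner v w"
  by (simp add: cinner_def sum_subtractf algebra_simps)

lemma cinner_smult_right: "dim_vec u = dim_vec v \<Longrightarrow> cinner u (c \<cdot>\<^sub>v v) = c * cinner u v"
  by (simp add: cinner_def sum_distrib_left algebra_simps)

lemma cinner_smult_left: "cinner (c \<cdot>\<^sub>v u) v = cnj c * cinner u v"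
  by (simp add: cinner_def sum_distrib_left algebra_simps)

lemma cinner_commute: "dim_vec u = dim_vec v \<Longrightarrow> cinner u v = cnj (cinner v u)"
  by (simp add: cinner_def mult.commute)

lemma cinner_self: "cinner v v = of_real (\<Sum>i<dim_vec v. (cmod (v $ i))\<^sup>2)"
  by (simp add: cinner_def complex_norm_square mult.commute del: of_real_power)

lemma cinner_self_Im [simp]: "Im (cinner v v) = 0"
  by (simp add: cinner_self)

lemma cinner_self_nonneg: "Re (cinner v v) \<ge> 0"
  by (simp add: cinner_self sum_nonneg)

lemma cinner_self_eq_0: "cinner v v = 0 \<Longrightarrow> v = 0\<^sub>v (dim_vec v)"
proof -
  assume "cinner v v = 0"
  then have "(\<Sum>i<dim_vec v. (cmod (v $ i))\<^sup>2) = 0" 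
    by (simp only: cinner_self of_real_eq_0_iff)
  then show ?thesis by (intro eq_vecI) (auto simp: sum_nonneg_eq_0_iff)
qed

lemma cinner_zero_right [simp]: "cinner u (0\<^sub>v (dim_vec u)) = 0"
  by (simp add: cinner_def)

lemma cinner_mult_mat:
  assumes "A \<in> carrier_mat m n" "dim_vec u = m" "dim_vec v = n"
  shows "cinner u (A *\<^sub>v v) = (\<Sum>i<m. \<Sum>j<n. cnj (u $ i) * A $$ (i,j) * v $ j)"
  using assms by (auto simp: cinner_def scalar_prod_def sum_distrib_left lessThan_atLeast0 mult.assoc intro!: sum.cong)

lemma adj_carrier: "A \<in> carrier_mat m n \<Longrightarrow> adj A \<in> carrier_mat n m"
  by (auto simp: adj_def)

lemma cinner_adj:
  assumes "A \<in> carrier_mat m n" "dim_vec u = m" "dim_vec v = n"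
  shows "cinner (adj A *\<^sub>v u) v = cinner u (A *\<^sub>v v)"
proof -
  have "cinner (adj A *\<^sub>v u) v = (\<Sum>j<n. \<Sum>i<m. cnj (u $ i) * A $$ (i,j) * v $ j)"
    using assms by (auto simp: cinner_def adj_def scalar_prod_def sum_distrib_right sum_distrib_left lessThan_atLeast0 mult_ac intro!: sum.cong)
  also have "\<dots> = (\<Sum>i<m. \<Sum>j<n. cnj (u $ i) * A $$ (i,j) * v $ j)"
    by (rule sum.swap)
  finally show ?thesis using cinner_mult_mat[OF assms] by simp
qed

lemma cinner_unitary:
  assumes "unitary_on d U" "dim_vec u = d" "dim_vec v = d"
  shows "cinner (U *\<^sub>v u) (U *\<^sub>v v) = cinner u v"
proof -
  have U: "U \<in> carrier_mat d d" "adj U * U = 1\<^sub>m d" using assms(1) by (auto simp: unitary_on_def)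
  have u: "u \<in> carrier_vec d" using assms(2) by auto
  have "cinner u v = cinner ((adj U * U) *\<^sub>v u) v"
    using U assms(2) by (metis carrier_vec_dim_vec one_mult_mat_vec)
  also have "\<dots> = cinner (adj U *\<^sub>v (U *\<^sub>v u)) v"
    using assoc_mult_mat_vec[OF adj_carrier[OF U(1)] U(1) u] by simp
  also have "\<dots> = cinner (U *\<^sub>v u) (U *\<^sub>v v)"
    using cinner_adj[OF U(1), of "U *\<^sub>v u" v] U(1) assms(3) by auto
  finally show ?thesis by simp
qed

lemma psd_onD:
  assumes "psd_on d E"
  shows "E \<in> carrier_mat d d" "adj E = E"
    "\<And>v. dim_vec v = d \<Longrightarrow> Im (cinner v (E *\<^sub>v v)) = 0"
    "\<And>v. dim_vec v = d \<Longrightarrow> prob v E \<ge> 0"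
  using assms by (auto simp: psd_on_def prob_def)

lemma cinner_psd_swap:
  assumes "psd_on d E" "dim_vec u = d" "dim_vec v = d"
  shows "cinner (E *\<^sub>v u) v = cinner u (E *\<^sub>v v)"
  using cinner_adj[of E d d u v] psd_onD[OF assms(1)] assms by simp

text \<open>Move from \<open>y\<close> in the direction -s * \<open>E y\<close>. The value of the
  form there is nonnegative, yet its linear term in s is -2 s times the squared norm of
  \<open>E y\<close>; for small s this forces \<open>E y\<close> to vanish.\<close>

lemma psd_kernel:
  assumes E: "psd_on d E" and y: "dim_vec y = d" and z: "prob y E = 0"
  shows "E *\<^sub>v y = 0\<^sub>v d"
proof -
  note c = psd_onD(1)[OF E]
  define w where "w = E *\<^sub>v y"
  have w: "dim_vec w = d" using c by (auto simp: w_def)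
  have yy: "cinner y (E *\<^sub>v y) = 0"
    using z psd_onD(3)[OF E y] by (auto simp: prob_def complex_eq_iff)
  have yw: "cinner y (E *\<^sub>v w) = cinner w w"
    using cinner_psd_swap[OF E y w] by (simp add: w_def)
  have "2 * Re (cinner w w) \<le> s * prob w E" if s: "s > 0" for s :: real
  proof -
    define r where "r = (- complex_of_real s) \<cdot>\<^sub>v w"
    have r: "dim_vec r = d" using w by (simp add: r_def)
    have Er: "E *\<^sub>v r = (- complex_of_real s) \<cdot>\<^sub>v (E *\<^sub>v w)"
      unfolding r_def using c w by (intro mult_mat_vec) auto
    have Ew: "dim_vec (E *\<^sub>v w) = d" using c by auto
    have d: "E *\<^sub>v (y + r) = w + E *\<^sub>v r"
      unfolding w_def using c y r by (intro mult_add_distrib_mat_vec[of _ d d]) (auto intro: carrier_vecI)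
    have Er': "dim_vec (E *\<^sub>v r) = d" using c by auto
    have "cinner (y + r) (E *\<^sub>v (y + r)) = (cinner y w + cinner y (E *\<^sub>v r)) + (cinner r w + cinner r (E *\<^sub>v r))"
      unfolding d using y r w Er'
      by (simp only: cinner_add_left[of y d r "w + E *\<^sub>v r"] cinner_add_right[of y d w "E *\<^sub>v r"]
        cinner_add_right[of r d w "E *\<^sub>v r"] index_add_vec)
    moreover have "cinner y w = 0" using yy by (simp only: w_def)
    moreover have "cinner y (E *\<^sub>v r) = - of_real s * cinner w w"
      unfolding Er using cinner_smult_right[of y "E *\<^sub>v w"] y Ew yw by (simp only:)
    moreover have "cinner r w = - of_real s * cinner w w"
      unfolding r_def by (simp only: cinner_smult_left complex_cnj_minus complex_cnj_complex_of_real)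
    moreover have "cinner r (E *\<^sub>v r) = of_real (s^2) * cinner w (E *\<^sub>v w)"
    proof -
      have "cinner r z = - of_real s * cinner w z" for z
        by (simp add: r_def cinner_smult_left)
      then have "cinner r (E *\<^sub>v r) = - of_real s * cinner w (- of_real s \<cdot>\<^sub>v (E *\<^sub>v w))"
        unfolding Er .
      also have "\<dots> = - of_real s * (- of_real s * cinner w (E *\<^sub>v w))"
        using cinner_smult_right[of w "E *\<^sub>v w" "- of_real s"] w Ew by (simp only:)
      finally show ?thesis by (simp add: power2_eq_square)
    qed
    ultimately have "cinner (y + r) (E *\<^sub>v (y + r)) = of_real (- 2 * s) * cinner w w + of_real (s^2) * cinner w (E *\<^sub>v w)"
      by simp
    from arg_cong[OF this, of Re] have "prob (y + r) E = - 2 * s * Re (cinner w w) + s^2 * prob w E"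
      unfolding prob_def by (simp only: plus_complex.sel times_complex.sel Re_complex_of_real Im_complex_of_real)
    moreover have "prob (y + r) E \<ge> 0" using psd_onD(4)[OF E, of "y+r"] y r by simp
    ultimately have "s * (2 * Re (cinner w w)) \<le> s * (s * prob w E)"
      by (simp add: power2_eq_square algebra_simps)
    then show ?thesis using s by simp
  qed
  note * = this
  have "Re (cinner w w) = 0"
  proof (rule ccontr)
    assume "Re (cinner w w) \<noteq> 0"
    then have pos: "Re (cinner w w) > 0" using cinner_self_nonneg[of w] by simp
    have pw: "prob w E \<ge> 0" using psd_onD(4)[OF E w] .
    \<comment> \<open>This s makes \<open>s * prob w E\<close> at most the squared norm of
      \<open>w\<close>, half of what the inequality demands. The \<open>+ 1\<close> keeps the
      quotient meaningful when \<open>prob w E\<close> is 0.\<close>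
    define s where "s = Re (cinner w w) / (prob w E + 1)"
    have "s > 0" using pos pw by (simp add: s_def)
    have "s * prob w E \<le> Re (cinner w w)"
    proof -
      have "Re (cinner w w) * (prob w E / (prob w E + 1)) \<le> Re (cinner w w) * 1"
        using pos pw by (intro mult_left_mono) (auto simp: divide_le_eq_1)
      then show ?thesis by (simp add: s_def)
    qed
    with *[OF \<open>s > 0\<close>] pos show False by simp
  qed
  then have "cinner w w = 0" by (simp add: complex_eq_iff)
  then have "w = 0\<^sub>v (dim_vec w)" by (rule cinner_self_eq_0)
  then show ?thesis unfolding w by (simp only: w_def)
qed

lemma prob_nonneg: "psd_on d E \<Longrightarrow> dim_vec v = d \<Longrightarrow> prob v E \<ge> 0"
  by (rule psd_onD(4))

lemma prob_smult: 
  assumes "E \<in> carrier_mat d d" "dim_vec v = d"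
  shows "prob (c \<cdot>\<^sub>v v) E = (cmod c)\<^sup>2 * prob v E"
proof -
  have "E *\<^sub>v (c \<cdot>\<^sub>v v) = c \<cdot>\<^sub>v (E *\<^sub>v v)" using assms by (intro mult_mat_vec) auto
  then have "cinner (c \<cdot>\<^sub>v v) (E *\<^sub>v (c \<cdot>\<^sub>v v)) = (c * cnj c) * cinner v (E *\<^sub>v v)"
    using assms by (simp add: cinner_smult_left cinner_smult_right)
  also have "c * cnj c = of_real ((cmod c)\<^sup>2)" by (simp only: complex_norm_square)
  finally show ?thesis by (simp add: prob_def del: of_real_power)
qed

text \<open>The cross terms for \<open>u + v\<close> and \<open>u - v\<close> cancel. In this form
  averaging over an unknown relative sign turns a superposition into a mixture.\<close>

lemma prob_parallelogram:
  assumes E: "E \<in> carrier_mat d d" and u: "dim_vec u = d" and v: "dim_vec v = d"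
  shows "prob (u + v) E + prob (u - v) E = 2 * prob u E + 2 * prob v E"
proof -
  have "cinner (u + v) (E *\<^sub>v (u + v)) + cinner (u - v) (E *\<^sub>v (u - v))
     = 2 * cinner u (E *\<^sub>v u) + 2 * cinner v (E *\<^sub>v v)"
    using E u v by (simp add: cinner_mult_mat[of E d d] sum_distrib_left sum.distrib[symmetric] algebra_simps)
  from arg_cong[OF this, of Re] show ?thesis by (simp add: prob_def)
qed

lemma prob_one: "dim_vec v = d \<Longrightarrow> prob v (1\<^sub>m d) = Re (cinner v v)"
  unfolding prob_def by (metis carrier_vecI one_mult_mat_vec)

lemma cinner_sum_mat:
  assumes "\<And>k. k \<in> S \<Longrightarrow> E k \<in> carrier_mat d d" "F \<in> carrier_mat d d" "dim_vec u = d" "dim_vec v = d"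
    and "\<And>i j. i < d \<Longrightarrow> j < d \<Longrightarrow> F $$ (i,j) = (\<Sum>k\<in>S. E k $$ (i,j))"
  shows "cinner u (F *\<^sub>v v) = (\<Sum>k\<in>S. cinner u (E k *\<^sub>v v))"
proof -
  have "(\<Sum>k\<in>S. cinner u (E k *\<^sub>v v)) = (\<Sum>k\<in>S. \<Sum>i<d. \<Sum>j<d. cnj (u $ i) * E k $$ (i,j) * v $ j)"
    using assms by (intro sum.cong refl cinner_mult_mat) auto
  also have "\<dots> = (\<Sum>i<d. \<Sum>j<d. \<Sum>k\<in>S. cnj (u $ i) * E k $$ (i,j) * v $ j)"
    by (simp only: sum.swap[of _ _ S])
  also have "\<dots> = cinner u (F *\<^sub>v v)"
    using assms by (simp add: cinner_mult_mat[of F d d] sum_distrib_left sum_distrib_right)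
  finally show ?thesis by simp
qed

lemma prob_sum_mat:
  assumes "\<And>k. k \<in> S \<Longrightarrow> E k \<in> carrier_mat d d" "F \<in> carrier_mat d d" "dim_vec v = d"
    and "\<And>i j. i < d \<Longrightarrow> j < d \<Longrightarrow> F $$ (i,j) = (\<Sum>k\<in>S. E k $$ (i,j))"
  shows "prob v F = (\<Sum>k\<in>S. prob v (E k))"
  unfolding prob_def using cinner_sum_mat[OF assms(1,2,3,3,4)] by (metis Re_sum)

lemma povm_onD:
  assumes "povm_on d E"
  shows "psd_on d (E k)" "E k \<in> carrier_mat d d"
  using assms by (auto simp: povm_on_def psd_on_def)

lemma prob_povm_sum:
  assumes "povm_on d E" "dim_vec v = d"
  shows "(\<Sum>k\<in>UNIV. prob v (E k)) = Re (cinner v v)"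
proof -
  have "prob v (1\<^sub>m d) = (\<Sum>k\<in>UNIV. prob v (E k))"
    using assms povm_onD[OF assms(1)] by (intro prob_sum_mat) (auto simp: povm_on_def)
  then show ?thesis using assms by (simp add: prob_one)
qed

lemma povm_zero_mult:
  assumes E: "povm_on d E" and y: "dim_vec y = d" and z: "(\<Sum>k\<in>S. prob y (E k)) = 0"
    and k: "k \<in> S" 
  shows "E k *\<^sub>v y = 0\<^sub>v d"
proof -
  have "finite S" by simp
  then have "prob y (E k) = 0"
    using z k prob_nonneg[OF povm_onD(1)[OF E] y] by (simp add: sum_nonneg_eq_0_iff)
  then show ?thesis using psd_kernel[OF povm_onD(1)[OF E] y] by simp
qed

text \<open>Error-free discrimination forces orthogonality: write the identity as the sum of all
  \<open>E k\<close>; each \<open>E k\<close> annihilates one of the two vectors, by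
  \<open>psd_kernel\<close>. The measurement may be any POVM.\<close>

lemma povm_orthogonal:
  assumes E: "povm_on d E" and y: "dim_vec y = d" and z: "dim_vec z = d"
    and zy: "(\<Sum>k\<in>S. prob y (E k)) = 0" and zz: "(\<Sum>k\<in>-S. prob z (E k)) = 0"
  shows "cinner y z = 0"
proof -
  have "cinner y (1\<^sub>m d *\<^sub>v z) = (\<Sum>k\<in>UNIV. cinner y (E k *\<^sub>v z))"
    using povm_onD[OF E] y z E by (intro cinner_sum_mat[of _ _ d]) (auto simp: povm_on_def)
  also have "\<dots> = 0"
  proof (rule sum.neutral, intro ballI)
    fix k
    show "cinner y (E k *\<^sub>v z) = 0"
    proof (cases "k \<in> S")
      case True
      then have "E k *\<^sub>v y = 0\<^sub>v d" using povm_zero_mult[OF E y zy] by simp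
      moreover have "cinner y (E k *\<^sub>v z) = cinner (E k *\<^sub>v y) z"
        using cinner_psd_swap[OF povm_onD(1)[OF E] y z] by simp
      ultimately show ?thesis using z by (simp add: cinner_def)
    next
      case False
      then have "E k *\<^sub>v z = 0\<^sub>v d" using povm_zero_mult[OF E z zz] by simp
      then show ?thesis using y by (metis cinner_zero_right)
    qed
  qed
  finally show ?thesis using z by (metis carrier_vec_dim_vec one_mult_mat_vec)
qed

section \<open>Tensor products\<close>

text \<open>On a tensor product this is the unnormalised state of the first factor when the second
  one, of dimension \<open>n\<close>, is in basis state \<open>j\<close>. The mirror image
  \<open>block\<close> fixes the first factor.\<close>

definition slice :: "nat \<Rightarrow> nat \<Rightarrow> complex vec \<Rightarrow> complex vec" where
  "slice n j v = vec (dim_vec v div n) (\<lambda>i. v $ (i*n+j))"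

definition block :: "nat \<Rightarrow> nat \<Rightarrow> complex vec \<Rightarrow> complex vec" where
  "block n i v = vec n (\<lambda>j. v $ (i*n+j))"

lemma dim_slice: "dim_vec v = m * n \<Longrightarrow> j < n \<Longrightarrow> dim_vec (slice n j v) = m"
  by (simp add: slice_def)

lemma slice_index: "dim_vec v = m * n \<Longrightarrow> j < n \<Longrightarrow> i < m \<Longrightarrow> slice n j v $ i = v $ (i*n+j)"
  by (simp add: slice_def)

lemma dim_block [simp]: "dim_vec (block n i v) = n"
  by (simp add: block_def)

lemma block_index [simp]: "j < n \<Longrightarrow> block n i v $ j = v $ (i*n+j)"
  by (simp add: block_def)

lemma slice_slice:
  assumes "dim_vec v = a * m * n" "i < m" "j < n"
  shows "slice m i (slice n j v) = slice (m*n) (i*n+j) v"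
proof (rule eq_vecI)
  have v: "dim_vec v = a * (m * n)" using assms by (simp add: mult.assoc)
  note ij = mult_add_less[OF assms(2,3)]
  have d: "dim_vec (slice n j v) = a * m" using assms dim_slice by blast
  show "dim_vec (slice m i (slice n j v)) = dim_vec (slice (m*n) (i*n+j) v)"
    using dim_slice[OF d assms(2)] dim_slice[OF v ij] by simp
  fix k assume "k < dim_vec (slice (m*n) (i*n+j) v)"
  then have k: "k < a" using dim_slice[OF v ij] by simp
  show "slice m i (slice n j v) $ k = slice (m*n) (i*n+j) v $ k"
    using slice_index[OF d assms(2) k] slice_index[OF assms(1,3) mult_add_less[OF k assms(2)]]
      slice_index[OF v ij k] by (simp add: algebra_simps)
qed

lemma mult_add_div: "j < n \<Longrightarrow> (i*n+j) div n = i" for i j n :: nat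
  by (cases "n = 0") auto

lemma kron_carrier: "A \<in> carrier_mat a b \<Longrightarrow> B \<in> carrier_mat c d \<Longrightarrow> kron A B \<in> carrier_mat (a*c) (b*d)"
  by (auto simp: kron_def)

lemma kron_index:
  assumes "A \<in> carrier_mat a b" "B \<in> carrier_mat c d" "i < a" "j < c" "k < b" "l < d"
  shows "kron A B $$ (i*c+j, k*d+l) = A $$ (i,k) * B $$ (j,l)"
  using assms by (auto simp: kron_def mult_add_less)

lemma kron_mult_vec_index:
  assumes "A \<in> carrier_mat a b" "B \<in> carrier_mat c d" "dim_vec v = b * d" "i < a" "j < c"
  shows "(kron A B *\<^sub>v v) $ (i*c+j) = (\<Sum>k<b. \<Sum>l<d. A $$ (i,k) * B $$ (j,l) * v $ (k*d+l))"
proof -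
  have ij: "i*c+j < a*c" using assms by (intro mult_add_less) auto
  have "(kron A B *\<^sub>v v) $ (i*c+j) = (\<Sum>k<b*d. kron A B $$ (i*c+j,k) * v $ k)"
    using kron_carrier[OF assms(1,2)] ij assms(3) by (auto simp: scalar_prod_def lessThan_atLeast0)
  also have "\<dots> = (\<Sum>k<b. \<Sum>l<d. A $$ (i,k) * B $$ (j,l) * v $ (k*d+l))"
    unfolding sum_lessThan_mult
    by (intro sum.cong refl) (simp add: kron_index[OF assms(1,2,4,5)])
  finally show ?thesis .
qed

lemma slice_kron:
  assumes A: "A \<in> carrier_mat m m" and v: "dim_vec v = m * n" and j: "j < n"
  shows "slice n j (kron A (1\<^sub>m n) *\<^sub>v v) = A *\<^sub>v slice n j v"
proof (rule eq_vecI)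
  have d: "dim_vec (kron A (1\<^sub>m n) *\<^sub>v v) = m * n" using kron_carrier[OF A one_carrier_mat, of n] by auto
  show "dim_vec (slice n j (kron A (1\<^sub>m n) *\<^sub>v v)) = dim_vec (A *\<^sub>v slice n j v)"
    using dim_slice[OF d j] A by simp
  fix i assume "i < dim_vec (A *\<^sub>v slice n j v)"
  then have i: "i < m" using A by simp
  have "slice n j (kron A (1\<^sub>m n) *\<^sub>v v) $ i = (\<Sum>k<m. \<Sum>l<n. A $$ (i,k) * 1\<^sub>m n $$ (j,l) * v $ (k*n+l))"
    unfolding slice_index[OF d j i] by (rule kron_mult_vec_index[OF A one_carrier_mat v i j])
  also have "\<dots> = (\<Sum>k<m. A $$ (i,k) * v $ (k*n+j))"
  proof (intro sum.cong refl)
    fix k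
    have "(\<Sum>l<n. A $$ (i,k) * 1\<^sub>m n $$ (j,l) * v $ (k*n+l)) = (\<Sum>l<n. if l = j then A $$ (i,k) * v $ (k*n+l) else 0)"
      using j by (intro sum.cong) auto
    then show "(\<Sum>l<n. A $$ (i,k) * 1\<^sub>m n $$ (j,l) * v $ (k*n+l)) = A $$ (i,k) * v $ (k*n+j)"
      using j by simp
  qed
  also have "\<dots> = (A *\<^sub>v slice n j v) $ i"
    using A i v j by (simp add: scalar_prod_def dim_slice slice_index lessThan_atLeast0)
  finally show "slice n j (kron A (1\<^sub>m n) *\<^sub>v v) $ i = (A *\<^sub>v slice n j v) $ i" .
qed

lemma block_kron:
  assumes B: "B \<in> carrier_mat n n" and v: "dim_vec v = m * n" and i: "i < m"
  shows "block n i (kron (1\<^sub>m m) B *\<^sub>v v) = B *\<^sub>v block n i v"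
proof (rule eq_vecI)
  show "dim_vec (block n i (kron (1\<^sub>m m) B *\<^sub>v v)) = dim_vec (B *\<^sub>v block n i v)"
    using B by simp
  fix j assume "j < dim_vec (B *\<^sub>v block n i v)"
  then have j: "j < n" using B by simp
  have "block n i (kron (1\<^sub>m m) B *\<^sub>v v) $ j = (\<Sum>k<m. \<Sum>l<n. 1\<^sub>m m $$ (i,k) * B $$ (j,l) * v $ (k*n+l))"
    unfolding block_index[OF j] by (rule kron_mult_vec_index[OF one_carrier_mat B v i j])
  also have "\<dots> = (\<Sum>k<m. if k = i then \<Sum>l<n. B $$ (j,l) * v $ (k*n+l) else 0)"
    using i by (intro sum.cong) auto
  also have "\<dots> = (B *\<^sub>v block n i v) $ j"
    using B i j v by (simp add: scalar_prod_def lessThan_atLeast0)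
  finally show "block n i (kron (1\<^sub>m m) B *\<^sub>v v) $ j = (B *\<^sub>v block n i v) $ j" .
qed

lemma cinner_slice:
  assumes "dim_vec u = m * n" "dim_vec v = m * n"
  shows "cinner u v = (\<Sum>j<n. cinner (slice n j u) (slice n j v))"
proof -
  have "cinner u v = (\<Sum>i<m. \<Sum>j<n. cnj (u $ (i*n+j)) * v $ (i*n+j))"
    unfolding cinner_def assms(1) by (rule sum_lessThan_mult)
  also have "\<dots> = (\<Sum>j<n. \<Sum>i<m. cnj (u $ (i*n+j)) * v $ (i*n+j))"
    by (rule sum.swap)
  also have "\<dots> = (\<Sum>j<n. cinner (slice n j u) (slice n j v))"
    using assms by (simp add: cinner_def dim_slice slice_index)
  finally show ?thesis .
qed

lemma cinner_block:
  assumes "dim_vec u = m * n" 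
  shows "cinner u v = (\<Sum>i<m. cinner (block n i u) (block n i v))"
  using assms by (simp add: cinner_def sum_lessThan_mult)

lemma cinner_kron_one_right:
  assumes A: "A \<in> carrier_mat m m" and v: "dim_vec v = m * n"
  shows "cinner v (kron A (1\<^sub>m n) *\<^sub>v v) = (\<Sum>j<n. cinner (slice n j v) (A *\<^sub>v slice n j v))"
proof -
  have "dim_vec (kron A (1\<^sub>m n) *\<^sub>v v) = m * n" using kron_carrier[OF A one_carrier_mat, of n] by auto
  then show ?thesis using slice_kron[OF A v] by (simp add: cinner_slice[OF v])
qed

lemma cinner_kron_one_left:
  assumes B: "B \<in> carrier_mat n n" and v: "dim_vec v = m * n"
  shows "cinner v (kron (1\<^sub>m m) B *\<^sub>v v) = (\<Sum>i<m. cinner (block n i v) (B *\<^sub>v block n i v))"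
  using block_kron[OF B v] by (simp add: cinner_block[OF v])

lemma prob_kron_one_right:
  assumes "A \<in> carrier_mat m m" "dim_vec v = m * n"
  shows "prob v (kron A (1\<^sub>m n)) = (\<Sum>j<n. prob (slice n j v) A)"
  using cinner_kron_one_right[OF assms] by (simp add: prob_def)

lemma prob_kron_one_left:
  assumes "B \<in> carrier_mat n n" "dim_vec v = m * n"
  shows "prob v (kron (1\<^sub>m m) B) = (\<Sum>i<m. prob (block n i v) B)"
  using cinner_kron_one_left[OF assms] by (simp add: prob_def)

lemma adj_kron: "adj (kron A B) = kron (adj A) (adj B)"
  by (intro eq_matI) (auto simp: kron_def adj_def div_less_mult mod_less_mult)

lemma adj_one [simp]: "adj (1\<^sub>m n) = 1\<^sub>m n"
  by (intro eq_matI) (auto simp: adj_def)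

lemma psd_kron_one:
  assumes "psd_on m A"
  shows "psd_on (m*n) (kron A (1\<^sub>m n))"
  unfolding psd_on_def
proof (intro conjI allI impI)
  note A = psd_onD[OF assms]
  show "kron A (1\<^sub>m n) \<in> carrier_mat (m*n) (m*n)" using kron_carrier[OF A(1) one_carrier_mat] .
  show "adj (kron A (1\<^sub>m n)) = kron A (1\<^sub>m n)" using A(2) by (simp add: adj_kron)
  fix v :: "complex vec" assume v: "dim_vec v = m * n"
  show "Im (cinner v (kron A (1\<^sub>m n) *\<^sub>v v)) = 0" 
    using A(3)[OF dim_slice[OF v]] by (simp add: cinner_kron_one_right[OF A(1) v])
  have "prob v (kron A (1\<^sub>m n)) \<ge> 0"
    unfolding prob_kron_one_right[OF A(1) v] by (intro sum_nonneg A(4) dim_slice[OF v]) auto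
  then show "Re (cinner v (kron A (1\<^sub>m n) *\<^sub>v v)) \<ge> 0" by (simp add: prob_def)
qed

lemma povm_kron_one:
  assumes "povm_on m E"
  shows "povm_on (m*n) (\<lambda>k. kron (E k) (1\<^sub>m n))"
  unfolding povm_on_def
proof (intro conjI allI impI)
  fix k show "psd_on (m*n) (kron (E k) (1\<^sub>m n))" using psd_kron_one povm_onD(1)[OF assms] by blast
next
  fix i j assume ij: "i < m*n" "j < m*n"
  have eq: "i = j \<longleftrightarrow> i div n = j div n \<and> i mod n = j mod n" by (metis div_mult_mod_eq)
  have E: "dim_row (E k) = m" "dim_col (E k) = m" for k using povm_onD(2)[OF assms, of k] by auto
  have "(\<Sum>k\<in>UNIV. kron (E k) (1\<^sub>m n) $$ (i,j)) 
      = (\<Sum>k\<in>UNIV. E k $$ (i div n, j div n)) * 1\<^sub>m n $$ (i mod n, j mod n)"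
    using ij by (simp add: kron_def E sum_distrib_right)
  also have "(\<Sum>k\<in>UNIV. E k $$ (i div n, j div n)) = (if i div n = j div n then 1 else 0)"
    using assms ij by (simp add: povm_on_def div_less_mult)
  finally show "(\<Sum>k\<in>UNIV. kron (E k) (1\<^sub>m n) $$ (i,j)) = (if i = j then 1 else 0)"
    using ij by (simp add: eq mod_less_mult)
qed

lemma dim_vkron [simp]: "dim_vec (vkron u v) = dim_vec u * dim_vec v"
  by (simp add: vkron_def)

lemma vkron_index: "i < dim_vec u \<Longrightarrow> j < dim_vec v \<Longrightarrow> vkron u v $ (i * dim_vec v + j) = u $ i * v $ j"
  by (simp add: vkron_def mult_add_less mult_add_div)

lemma cinner_vkron:
  assumes u: "dim_vec u = m" "dim_vec u' = m" and v: "dim_vec v = n" "dim_vec v' = n"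
  shows "cinner (vkron u v) (vkron u' v') = cinner u u' * cinner v v'"
proof -
  have "cinner (vkron u v) (vkron u' v') = (\<Sum>i<m. \<Sum>j<n. (cnj (u $ i) * u' $ i) * (cnj (v $ j) * v' $ j))"
    unfolding cinner_def dim_vkron u v sum_lessThan_mult
  proof (intro sum.cong refl)
    fix i j assume "i \<in> {..<m}" "j \<in> {..<n}"
    then have "vkron u v $ (i*n+j) = u $ i * v $ j" "vkron u' v' $ (i*n+j) = u' $ i * v' $ j"
      using vkron_index[of i u j v] vkron_index[of i u' j v'] u v by auto
    then show "cnj (vkron u v $ (i*n+j)) * vkron u' v' $ (i*n+j) = (cnj (u $ i) * u' $ i) * (cnj (v $ j) * v' $ j)"
      by simp
  qed
  then show ?thesis by (simp add: cinner_def sum_product u v)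
qed

section \<open>Projective measurements and elementary unitaries\<close>

text \<open>For nonzero \<open>w\<close> this is the orthogonal projector onto its line; the
  quotient absorbs the normalisation of \<open>w\<close>.\<close>

definition outer :: "complex vec \<Rightarrow> complex mat" where
  "outer w = mat (dim_vec w) (dim_vec w) (\<lambda>(i,j). w $ i * cnj (w $ j) / cinner w w)"

lemma outer_mult_vec:
  assumes "dim_vec w = d" "dim_vec u = d"
  shows "outer w *\<^sub>v u = (cinner w u / cinner w w) \<cdot>\<^sub>v w"
  using assms by (intro eq_vecI)
    (auto simp: outer_def cinner_def[of w u] scalar_prod_def sum_distrib_left sum_distrib_right lessThan_atLeast0
      sum_divide_distrib mult_ac intro!: sum.cong)

lemma adj_outer: "adj (outer w) = outer w"
  using cinner_commute[of w w] by (intro eq_matI) (auto simp: adj_def outer_def)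

definition projector_on :: "nat \<Rightarrow> complex mat \<Rightarrow> bool" where
  "projector_on d Q \<longleftrightarrow> Q \<in> carrier_mat d d \<and> adj Q = Q \<and> (\<forall>u. dim_vec u = d \<longrightarrow> Q *\<^sub>v (Q *\<^sub>v u) = Q *\<^sub>v u)"

lemma cinner_projector:
  assumes "projector_on d Q" "dim_vec u = d" "dim_vec v = d"
  shows "cinner (Q *\<^sub>v u) v = cinner u (Q *\<^sub>v v)"
  using cinner_adj[of Q d d u v] assms by (simp add: projector_on_def)

text \<open>Gram-Schmidt by induction on the list: the residual of the new vector is either zero or
  contributes a rank-one projector. The last clause, annihilating everything orthogonal to the list,
  later makes the decoder recognise the opposite bit value.\<close>

lemma exists_projector_onto:
  assumes "\<And>v. v \<in> set vs \<Longrightarrow> dim_vec v = d"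
  shows "\<exists>Q. projector_on d Q \<and> (\<forall>v\<in>set vs. Q *\<^sub>v v = v) \<and>
     (\<forall>u. dim_vec u = d \<and> (\<forall>v\<in>set vs. cinner v u = 0) \<longrightarrow> Q *\<^sub>v u = 0\<^sub>v d)"
  using assms
proof (induction vs)
  case Nil
  have "adj (0\<^sub>m d d) = 0\<^sub>m d d" by (intro eq_matI) (auto simp: adj_def)
  moreover have Z: "0\<^sub>m d d *\<^sub>v u = 0\<^sub>v d" if "dim_vec u = d" for u :: "complex vec"
    using that by (intro eq_vecI) (auto simp: scalar_prod_def)
  ultimately have "projector_on d (0\<^sub>m d d)" by (auto simp: projector_on_def)
  then show ?case using Z by (intro exI[of _ "0\<^sub>m d d"]) auto
next
  case (Cons x vs)
  have x: "dim_vec x = d" and vs: "\<And>v. v \<in> set vs \<Longrightarrow> dim_vec v = d" using Cons.prems by auto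
  obtain Q where Q: "projector_on d Q" "\<And>v. v \<in> set vs \<Longrightarrow> Q *\<^sub>v v = v"
    "\<And>u. dim_vec u = d \<Longrightarrow> (\<And>v. v \<in> set vs \<Longrightarrow> cinner v u = 0) \<Longrightarrow> Q *\<^sub>v u = 0\<^sub>v d"
    using Cons.IH[OF vs] by blast
  have Qc: "Q \<in> carrier_mat d d" and Qa: "adj Q = Q"
    and QQ: "\<And>u. dim_vec u = d \<Longrightarrow> Q *\<^sub>v (Q *\<^sub>v u) = Q *\<^sub>v u"
    using Q(1) by (auto simp: projector_on_def)
  have dQ: "dim_vec (Q *\<^sub>v u) = d" for u using Qc by simp
  define y where "y = x - Q *\<^sub>v x"
  have y: "dim_vec y = d" using dQ by (simp add: y_def)
  have Qy: "Q *\<^sub>v y = 0\<^sub>v d"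
  proof -
    have "Q *\<^sub>v y = Q *\<^sub>v x - Q *\<^sub>v (Q *\<^sub>v x)"
      unfolding y_def using Qc x dQ by (intro mult_minus_distrib_mat_vec[of _ d d]) (auto intro: carrier_vecI)
    also have "\<dots> = 0\<^sub>v d" using QQ[OF x] dQ by (metis carrier_vecI minus_cancel_vec)
    finally show ?thesis .
  qed
  \<comment> \<open>The residual \<open>y\<close> is orthogonal to the range of \<open>Q\<close>, so
    the sum of \<open>Q\<close> and the projector onto \<open>y\<close> is again a
    projector.\<close>
  have yQ: "cinner y (Q *\<^sub>v u) = 0" if "dim_vec u = d" for u
    using cinner_projector[OF Q(1) y that] Qy that by (simp add: cinner_def)
  have xy: "x = y + Q *\<^sub>v x" using x dQ by (intro eq_vecI) (auto simp: y_def)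
  show ?case
  proof (cases "y = 0\<^sub>v d")
    case True
    then have "Q *\<^sub>v x = x" using xy dQ by (metis carrier_vecI left_zero_vec)
    then show ?thesis using Q by (intro exI[of _ Q]) auto
  next
    case False
    then have N: "cinner y y \<noteq> 0" using cinner_self_eq_0[of y] y by auto
    define R where "R = outer y"
    have Rc: "R \<in> carrier_mat d d" using y by (auto simp: R_def outer_def)
    have R: "R *\<^sub>v u = (cinner y u / cinner y y) \<cdot>\<^sub>v y" if "dim_vec u = d" for u
      unfolding R_def using outer_mult_vec[OF y that] .
    have Ra: "(Q + R) *\<^sub>v u = Q *\<^sub>v u + R *\<^sub>v u" if "dim_vec u = d" for u
      using Qc Rc that by (intro add_mult_distrib_mat_vec[of _ d d]) (auto intro: carrier_vecI)
    have S: "(Q + R) *\<^sub>v u = Q *\<^sub>v u + (cinner y u / cinner y y) \<cdot>\<^sub>v y" if "dim_vec u = d" for u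
      using Ra[OF that] R[OF that] by simp
    have SQ: "(Q + R) *\<^sub>v u = u" if u: "dim_vec u = d" and "Q *\<^sub>v u = u" for u
    proof -
      have "cinner y u = 0" using yQ[OF u] that(2) by simp
      then show ?thesis using S[OF u] that y by (intro eq_vecI) auto
    qed
    have Sy: "(Q + R) *\<^sub>v y = y"
      using S[OF y] N y by (intro eq_vecI) (auto simp: Qy)
    have add: "(Q + R) *\<^sub>v (u + c \<cdot>\<^sub>v y) = u + c \<cdot>\<^sub>v y" if u: "dim_vec u = d" and "Q *\<^sub>v u = u" for u c
    proof -
      have "(Q + R) *\<^sub>v (u + c \<cdot>\<^sub>v y) = (Q + R) *\<^sub>v u + (Q + R) *\<^sub>v (c \<cdot>\<^sub>v y)"
        using Qc Rc u y by (intro mult_add_distrib_mat_vec[of _ d d]) (auto intro: carrier_vecI)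
      also have "(Q + R) *\<^sub>v (c \<cdot>\<^sub>v y) = c \<cdot>\<^sub>v ((Q + R) *\<^sub>v y)"
        using Qc Rc y by (intro mult_mat_vec[of _ d d]) (auto intro: carrier_vecI)
      finally show ?thesis using SQ[OF that] Sy by simp
    qed
    have "projector_on d (Q + R)"
      unfolding projector_on_def
    proof (intro conjI allI impI)
      show "Q + R \<in> carrier_mat d d" using Qc Rc by simp
      have "adj (Q + R) = adj Q + adj R"
        using Qc Rc by (intro eq_matI) (auto simp: adj_def)
      then show "adj (Q + R) = Q + R" using Qa adj_outer by (simp add: R_def)
      fix u :: "complex vec" assume u: "dim_vec u = d"
      show "(Q + R) *\<^sub>v ((Q + R) *\<^sub>v u) = (Q + R) *\<^sub>v u"
        unfolding S[OF u] using add[OF dQ QQ[OF u]] .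
    qed
    moreover have "(Q + R) *\<^sub>v v = v" if "v \<in> set (x # vs)" for v
    proof (cases "v = x")
      case True
      have "(Q + R) *\<^sub>v (Q *\<^sub>v x + 1 \<cdot>\<^sub>v y) = Q *\<^sub>v x + 1 \<cdot>\<^sub>v y"
        by (rule add[OF dQ QQ[OF x]])
      moreover have "Q *\<^sub>v x + 1 \<cdot>\<^sub>v y = x" using x dQ by (intro eq_vecI) (auto simp: y_def)
      ultimately show ?thesis using True by simp
    next
      case False
      then show ?thesis using SQ vs Q(2) that by auto
    qed
    moreover have "(Q + R) *\<^sub>v u = 0\<^sub>v d" if u: "dim_vec u = d" and o: "\<And>v. v \<in> set (x # vs) \<Longrightarrow> cinner v u = 0" for u
    proof -
      have Qu: "Q *\<^sub>v u = 0\<^sub>v d" using Q(3)[OF u] o by simp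
      have "cinner x u = cinner y u + cinner (Q *\<^sub>v x) u"
        using cinner_add_left[OF y dQ u] xy by metis
      moreover have "cinner (Q *\<^sub>v x) u = 0"
        using cinner_projector[OF Q(1) x u] Qu x by (metis cinner_zero_right)
      ultimately have "cinner y u = 0" using o by simp
      then show ?thesis using S[OF u] Qu y by (intro eq_vecI) auto
    qed
    ultimately show ?thesis by (intro exI[of _ "Q + R"]) blast
  qed
qed

lemma projector_psd:
  assumes "projector_on d Q"
  shows "psd_on d Q" "psd_on d (1\<^sub>m d - Q)"
proof -
  have Q: "Q \<in> carrier_mat d d" "adj Q = Q" 
    and QQ: "\<And>u. dim_vec u = d \<Longrightarrow> Q *\<^sub>v (Q *\<^sub>v u) = Q *\<^sub>v u"
    using assms by (auto simp: projector_on_def)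
  have dQ: "dim_vec (Q *\<^sub>v u) = d" for u using Q by simp
  have 1: "cinner u (Q *\<^sub>v u) = cinner (Q *\<^sub>v u) (Q *\<^sub>v u)" if "dim_vec u = d" for u
    using cinner_projector[OF assms that dQ[of u]] QQ[OF that] by simp
  then show "psd_on d Q" using Q cinner_self_nonneg by (auto simp: psd_on_def)
  have M: "(1\<^sub>m d - Q) *\<^sub>v u = u - Q *\<^sub>v u" if "dim_vec u = d" for u
  proof -
    have "(1\<^sub>m d - Q) *\<^sub>v u = 1\<^sub>m d *\<^sub>v u - Q *\<^sub>v u"
      using Q that by (intro minus_mult_distrib_mat_vec[of _ d d]) (auto intro: carrier_vecI)
    then show ?thesis using that by (metis carrier_vecI one_mult_mat_vec)
  qed
  have 2: "cinner u ((1\<^sub>m d - Q) *\<^sub>v u) = cinner (u - Q *\<^sub>v u) (u - Q *\<^sub>v u)" if u: "dim_vec u = d" for u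
  proof -
    have "cinner (u - Q *\<^sub>v u) (u - Q *\<^sub>v u) = cinner u (u - Q *\<^sub>v u) - cinner (Q *\<^sub>v u) (u - Q *\<^sub>v u)"
      using u dQ by (intro cinner_diff_left[of _ d]) auto
    also have "cinner (Q *\<^sub>v u) (u - Q *\<^sub>v u) = cinner (Q *\<^sub>v u) u - cinner (Q *\<^sub>v u) (Q *\<^sub>v u)"
      using u dQ by (intro cinner_diff_right[of _ d]) auto
    also have "\<dots> = 0" using cinner_projector[OF assms u u] 1[OF u] by simp
    finally have "cinner (u - Q *\<^sub>v u) (u - Q *\<^sub>v u) = cinner u (u - Q *\<^sub>v u)" by simp
    then show ?thesis using M[OF u] by simp
  qed
  have "adj (1\<^sub>m d - Q) = 1\<^sub>m d - adj Q"
    using Q(1) by (intro eq_matI) (auto simp: adj_def)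
  then show "psd_on d (1\<^sub>m d - Q)"
    using Q 2 cinner_self_nonneg by (auto simp: psd_on_def)
qed

text \<open>Entry k of the image is entry \<open>s k\<close> of the argument. The maps
  \<open>s\<close> used below are involutions, which makes the matrix its own adjoint.\<close>

definition perm_mat :: "nat \<Rightarrow> (nat \<Rightarrow> nat) \<Rightarrow> complex mat" where
  "perm_mat N s = mat N N (\<lambda>(k,l). if l = s k then 1 else 0)"

lemma perm_mat_carrier [simp]: "perm_mat N s \<in> carrier_mat N N"
  by (simp add: perm_mat_def)

lemma perm_mat_mult_vec:
  assumes "dim_vec v = N" "k < N" "s k < N"
  shows "(perm_mat N s *\<^sub>v v) $ k = v $ s k"
proof -
  have "(perm_mat N s *\<^sub>v v) $ k = (\<Sum>l<N. (if l = s k then 1 else 0) * v $ l)"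
    using assms by (simp add: perm_mat_def scalar_prod_def lessThan_atLeast0)
  also have "\<dots> = (\<Sum>l<N. if l = s k then v $ l else 0)"
    by (intro sum.cong) auto
  finally have "(perm_mat N s *\<^sub>v v) $ k = (\<Sum>l<N. if l = s k then v $ l else 0)" .
  then show ?thesis using assms by simp
qed

lemma unitary_perm_mat:
  assumes "\<And>k. k < N \<Longrightarrow> s k < N" "\<And>k. k < N \<Longrightarrow> s (s k) = k"
  shows "unitary_on N (perm_mat N s)"
proof -
  have "adj (perm_mat N s) = perm_mat N s"
    using assms by (intro eq_matI) (auto simp: adj_def perm_mat_def)
  moreover have "perm_mat N s * perm_mat N s = 1\<^sub>m N"
  proof (rule eq_matI)
    fix k l assume kl: "k < dim_row (1\<^sub>m N :: complex mat)" "l < dim_col (1\<^sub>m N :: complex mat)"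
    then have "(perm_mat N s * perm_mat N s) $$ (k,l) = (\<Sum>i<N. (if i = s k then 1 else 0) * (if l = s i then 1 else 0))"
      by (simp add: perm_mat_def scalar_prod_def lessThan_atLeast0)
    also have "\<dots> = (\<Sum>i<N. if i = s k then (if l = s i then 1 else 0) else 0)"
      by (intro sum.cong) auto
    also have "\<dots> = (if l = k then 1 else 0)" using assms kl by simp
    finally show "(perm_mat N s * perm_mat N s) $$ (k,l) = 1\<^sub>m N $$ (k,l)" using kl by simp
  qed (auto simp: perm_mat_def)
  ultimately show ?thesis by (simp add: unitary_on_def)
qed

definition diag_phase :: "nat \<Rightarrow> (nat \<Rightarrow> complex) \<Rightarrow> complex mat" where
  "diag_phase N f = mat N N (\<lambda>(k,l). if k = l then f k else 0)"

lemma diag_phase_carrier [simp]: "diag_phase N f \<in> carrier_mat N N"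
  by (simp add: diag_phase_def)

lemma diag_phase_mult_vec:
  assumes "dim_vec v = N" "k < N"
  shows "(diag_phase N f *\<^sub>v v) $ k = f k * v $ k"
proof -
  have "(diag_phase N f *\<^sub>v v) $ k = (\<Sum>l<N. (if k = l then f k else 0) * v $ l)"
    using assms by (simp add: diag_phase_def scalar_prod_def lessThan_atLeast0)
  also have "\<dots> = (\<Sum>l<N. if l = k then f k * v $ l else 0)"
    by (intro sum.cong) auto
  finally have "(diag_phase N f *\<^sub>v v) $ k = (\<Sum>l<N. if l = k then f k * v $ l else 0)" .
  then show ?thesis using assms by simp
qed

lemma diag_phase_mult: "diag_phase N f * diag_phase N g = diag_phase N (\<lambda>k. f k * g k)"
proof (rule eq_matI)
  fix k l assume kl: "k < dim_row (diag_phase N (\<lambda>k. f k * g k))" "l < dim_col (diag_phase N (\<lambda>k. f k * g k))"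
  then have "(diag_phase N f * diag_phase N g) $$ (k,l) = (\<Sum>i<N. (if k = i then f k else 0) * (if i = l then g i else 0))"
    by (simp add: diag_phase_def scalar_prod_def lessThan_atLeast0)
  also have "\<dots> = (\<Sum>i<N. if i = k then (if k = l then f k * g k else 0) else 0)"
    by (intro sum.cong) auto
  finally show "(diag_phase N f * diag_phase N g) $$ (k,l) = diag_phase N (\<lambda>k. f k * g k) $$ (k,l)"
    using kl by (simp add: diag_phase_def)
qed (auto simp: diag_phase_def)

lemma unitary_diag_phase:
  assumes "\<And>k. k < N \<Longrightarrow> cmod (f k) = 1"
  shows "unitary_on N (diag_phase N f)"
proof -
  have "adj (diag_phase N f) = diag_phase N (\<lambda>k. cnj (f k))"
    by (intro eq_matI) (auto simp: adj_def diag_phase_def)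
  moreover have "diag_phase N (\<lambda>k. f k * cnj (f k)) = 1\<^sub>m N" "diag_phase N (\<lambda>k. cnj (f k) * f k) = 1\<^sub>m N"
    using assms by (auto intro!: eq_matI simp: diag_phase_def complex_norm_square[symmetric] mult.commute[of "cnj _"])
  ultimately show ?thesis by (simp add: unitary_on_def diag_phase_mult)
qed

lemma cinner_kron_unitary:
  assumes U: "unitary_on m U" and u: "dim_vec u = m * n" and v: "dim_vec v = m * n"
  shows "cinner (kron U (1\<^sub>m n) *\<^sub>v u) (kron U (1\<^sub>m n) *\<^sub>v v) = cinner u v"
proof -
  have Uc: "U \<in> carrier_mat m m" using U by (simp add: unitary_on_def)
  have d: "dim_vec (kron U (1\<^sub>m n) *\<^sub>v x) = m * n" for x using kron_carrier[OF Uc one_carrier_mat, of n] by auto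
  have "cinner (kron U (1\<^sub>m n) *\<^sub>v u) (kron U (1\<^sub>m n) *\<^sub>v v) = (\<Sum>j<n. cinner (U *\<^sub>v slice n j u) (U *\<^sub>v slice n j v))"
    by (simp add: cinner_slice[OF d d] slice_kron[OF Uc u] slice_kron[OF Uc v])
  also have "\<dots> = cinner u v"
    unfolding cinner_slice[OF u v] by (intro sum.cong refl cinner_unitary[OF U] dim_slice[OF u] dim_slice[OF v]) auto
  finally show ?thesis .
qed

text \<open>Honest Bob never aborts. The restriction on a cheating Alice comes from the certainty
  demand alone, not from being caught.\<close>

definition accept :: "nat \<Rightarrow> bool \<Rightarrow> complex mat" where
  "accept k r = (if r then 1\<^sub>m k else 0\<^sub>m k k)"

lemma psd_one: "psd_on k (1\<^sub>m k)"
  unfolding psd_on_def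
proof (intro conjI allI impI)
  fix v :: "complex vec" assume "dim_vec v = k"
  then have "1\<^sub>m k *\<^sub>v v = v" by (metis carrier_vecI one_mult_mat_vec)
  then show "Im (cinner v (1\<^sub>m k *\<^sub>v v)) = 0" "Re (cinner v (1\<^sub>m k *\<^sub>v v)) \<ge> 0"
    using cinner_self_nonneg by auto
qed simp_all

lemma psd_zero: "psd_on k (0\<^sub>m k k)"
proof -
  have "adj (0\<^sub>m k k) = 0\<^sub>m k k" by (intro eq_matI) (auto simp: adj_def)
  moreover have "cinner v (0\<^sub>m k k *\<^sub>v v) = 0" if "dim_vec v = k" for v
    using that by (simp add: cinner_mult_mat[of _ k k])
  ultimately show ?thesis by (auto simp: psd_on_def)
qed

lemma povm_accept: "povm_on k (accept k)"
  using psd_one psd_zero by (auto simp: povm_on_def accept_def UNIV_bool)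

lemma prob_kron_zero_right:
  assumes "A \<in> carrier_mat m m" "dim_vec v = m * k"
  shows "prob v (kron A (0\<^sub>m k k)) = 0"
proof -
  have "kron A (0\<^sub>m k k) = 0\<^sub>m (m*k) (m*k)"
    using assms(1) by (intro eq_matI) (auto simp: kron_def mod_less_mult)
  then show ?thesis using assms(2) by (simp add: prob_def cinner_mult_mat[of _ "m*k" "m*k"])
qed

lemma jprob_accept:
  fixes E :: "'o::finite \<Rightarrow> complex mat"
  assumes "\<And>g. E g \<in> carrier_mat m m" "dim_vec v = m * k"
  shows "jprob v E (accept k) R = (\<Sum>g | R g True. prob v (kron (E g) (1\<^sub>m k)))"
proof -
  have "jprob v E (accept k) R = (\<Sum>g\<in>UNIV. if R g True then prob v (kron (E g) (1\<^sub>m k)) else 0)"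
    using prob_kron_zero_right[OF assms] unfolding jprob_def accept_def
    by (intro sum.cong refl) (auto simp: UNIV_bool)
  then show ?thesis by (simp add: sum.If_cases)
qed

section \<open>Diagonal phases on the message register and the weights they preserve\<close>

definition modulate :: "nat \<Rightarrow> (nat \<Rightarrow> complex) \<Rightarrow> complex vec \<Rightarrow> complex vec" where
  "modulate m f v = vec (dim_vec v) (\<lambda>k. f (k mod m) * v $ k)"

text \<open>The probability of finding the message register, the second tensor factor, in basis
  state \<open>i\<close>. By \<open>cinner_modulate\<close>, overlaps between differently modulated
  copies of a state depend on that state only through these numbers.\<close>

definition weight :: "nat \<Rightarrow> complex vec \<Rightarrow> nat \<Rightarrow> real" where
  "weight m v i = (\<Sum>j<dim_vec v div m. (cmod (v $ (j*m+i)))\<^sup>2)"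

lemma dim_modulate [simp]: "dim_vec (modulate m f v) = dim_vec v"
  by (simp add: modulate_def)

lemma weight_nonneg: "weight m v i \<ge> 0"
  by (simp add: weight_def sum_nonneg)

lemma cinner_modulate:
  assumes v: "dim_vec v = d * m"
  shows "cinner (modulate m f v) (modulate m g v) = (\<Sum>i<m. of_real (weight m v i) * cnj (f i) * g i)"
proof (cases "m = 0")
  case True then show ?thesis using v by (simp add: cinner_def)
next
  case False
  then have dd: "dim_vec v div m = d" using v by simp
  have "cinner (modulate m f v) (modulate m g v) = (\<Sum>j<d. \<Sum>i<m. of_real ((cmod (v $ (j*m+i)))\<^sup>2) * cnj (f i) * g i)"
    unfolding cinner_def dim_modulate v sum_lessThan_mult
  proof (intro sum.cong refl)
    fix j i assume "j \<in> {..<d}" "i \<in> {..<m}"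
    then have "(j*m+i) < d*m" "i < m" using mult_add_less by auto
    then show "cnj (modulate m f v $ (j*m+i)) * modulate m g v $ (j*m+i) = of_real ((cmod (v $ (j*m+i)))\<^sup>2) * cnj (f i) * g i"
      using v by (simp add: modulate_def complex_norm_square del: of_real_power)
  qed
  also have "\<dots> = (\<Sum>i<m. \<Sum>j<d. of_real ((cmod (v $ (j*m+i)))\<^sup>2) * cnj (f i) * g i)"
    by (rule sum.swap)
  also have "\<dots> = (\<Sum>i<m. of_real (weight m v i) * cnj (f i) * g i)"
    unfolding weight_def dd by (simp add: sum_distrib_right)
  finally show ?thesis .
qed

section \<open>Protocols in which Bob applies diagonal phases\<close>

lemma less_mult_cases:
  fixes k m n :: nat
  assumes "k < m * n"
  obtains i j where "i < m" "j < n" "k = i*n+j"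
  using assms by (metis div_less_mult div_mult_mod_eq mod_less_mult)

lemma kron_one_right_index:
  assumes "A \<in> carrier_mat m m" "dim_vec v = m * n" "i < m" "j < n"
  shows "(kron A (1\<^sub>m n) *\<^sub>v v) $ (i*n+j) = (A *\<^sub>v slice n j v) $ i"
proof -
  have "dim_vec (kron A (1\<^sub>m n) *\<^sub>v v) = m * n" using kron_carrier[OF assms(1) one_carrier_mat, of n] by auto
  then show ?thesis using slice_index[of _ m n j i] slice_kron[OF assms(1,2,4)] assms by metis
qed

lemma block_vkron:
  assumes "dim_vec u = a * b" "dim_vec v = d" "i < a"
  shows "block (b*d) i (vkron u v) = vkron (block b i u) v"
proof (rule eq_vecI)
  fix k assume "k < dim_vec (vkron (block b i u) v)"
  then have "k < b * d" using assms by simp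
  then obtain j l where jl: "j < b" "l < d" "k = j*d+l" by (rule less_mult_cases)
  have "block (b*d) i (vkron u v) $ k = vkron u v $ ((i*b+j)*d+l)"
    using jl mult_add_less[OF jl(1,2)] by (simp add: algebra_simps)
  also have "\<dots> = u $ (i*b+j) * v $ l"
    using vkron_index[of "i*b+j" u l v] mult_add_less[OF assms(3) jl(1)] assms jl by simp
  also have "\<dots> = vkron (block b i u) v $ k"
    using vkron_index[of j "block b i u" l v] assms jl by simp
  finally show "block (b*d) i (vkron u v) $ k = vkron (block b i u) v $ k" .
qed (use assms in simp)

lemma vkron_smult_left: "vkron (c \<cdot>\<^sub>v u) v = c \<cdot>\<^sub>v vkron u v"
  by (intro eq_vecI) (auto simp: vkron_def div_less_mult)

text \<open>Bob's accepting operator is the identity on message and coin together. Grouping by the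
  coin value alone keeps Alice's and the message register intact, so the final state can be treated
  as a mixture over coin values.\<close>

lemma prob_kron_one_mult:
  assumes "A \<in> carrier_mat a a" "dim_vec v = a * m * n"
  shows "prob v (kron A (1\<^sub>m (m*n))) = (\<Sum>t<n. prob (slice n t v) (kron A (1\<^sub>m m)))"
proof -
  have "prob v (kron A (1\<^sub>m (m*n))) = (\<Sum>i<m. \<Sum>t<n. prob (slice (m*n) (i*n+t) v) A)"
    using assms by (simp add: prob_kron_one_right mult.assoc sum_lessThan_mult)
  also have "\<dots> = (\<Sum>i<m. \<Sum>t<n. prob (slice m i (slice n t v)) A)"
    using slice_slice[OF assms(2)] by (intro sum.cong refl arg_cong2[where f=prob]) auto
  also have "\<dots> = (\<Sum>t<n. \<Sum>i<m. prob (slice m i (slice n t v)) A)"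
    by (rule sum.swap)
  also have "\<dots> = (\<Sum>t<n. prob (slice n t v) (kron A (1\<^sub>m m)))"
    using prob_kron_one_right[OF assms(1) dim_slice[OF assms(2)]] by (intro sum.cong refl) auto
  finally show ?thesis .
qed

section \<open>The controlled transposition that undoes Alice's copy\<close>

definition swp :: "nat \<Rightarrow> nat \<Rightarrow> nat" where
  "swp i j = (if j = i then 0 else if j = 0 then i else j)"

lemma swp_less: "i < m \<Longrightarrow> j < m \<Longrightarrow> swp i j < m"
  by (auto simp: swp_def)

lemma swp_swp: "swp i (swp i j) = j"
  by (auto simp: swp_def)

lemma swp_eq_iff: "swp i j = i \<longleftrightarrow> j = 0"
  by (auto simp: swp_def)

text \<open>Maps \<open>|i,i\<rangle>\<close> to \<open>|i,0\<rangle>\<close>. It is controlled by Alice's register, independently of her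
  choice bit, so returning the message register afterwards tells a cheating Bob nothing about that bit
  beyond the value of \<open>i\<close>.\<close>

definition uncopy :: "nat \<Rightarrow> complex mat" where
  "uncopy m = perm_mat (m*m) (\<lambda>k. (k div m) * m + swp (k div m) (k mod m))"

lemma uncopy_carrier [simp]: "uncopy m \<in> carrier_mat (m*m) (m*m)"
  by (simp add: uncopy_def)

lemma unitary_uncopy: "unitary_on (m*m) (uncopy m)"
  unfolding uncopy_def
proof (rule unitary_perm_mat)
  fix k assume "k < m * m"
  then obtain i j where ij: "i < m" "j < m" "k = i*m+j" by (rule less_mult_cases)
  note s = swp_less[OF ij(1,2)]
  show "k div m * m + swp (k div m) (k mod m) < m * m"
    using ij mult_add_less[OF ij(1) s] by (simp add: mult_add_div)
  show "(k div m * m + swp (k div m) (k mod m)) div m * m +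
      swp ((k div m * m + swp (k div m) (k mod m)) div m) ((k div m * m + swp (k div m) (k mod m)) mod m) = k"
    using ij s by (simp add: mult_add_div swp_swp)
qed

lemma uncopy_mult_vec:
  assumes "dim_vec v = m * m" "i < m" "j < m"
  shows "(uncopy m *\<^sub>v v) $ (i*m+j) = v $ (i*m + swp i j)"
proof -
  have "(i*m+j) div m = i" "(i*m+j) mod m = j" using assms by (simp_all add: mult_add_div)
  then show ?thesis unfolding uncopy_def
    using perm_mat_mult_vec[OF assms(1), of "i*m+j" "\<lambda>k. (k div m) * m + swp (k div m) (k mod m)"]
      mult_add_less[OF assms(2,3)] mult_add_less[OF assms(2) swp_less[OF assms(2,3)]] by simp
qed

text \<open>For a fixed value \<open>i\<close> of Alice's register the map is a fixed unitary on the
  message. Hence what Bob holds in that block depends on the choice bit only through a scalar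
  factor.\<close>

lemma block_kron_uncopy:
  assumes v: "dim_vec v = m * (m * d)" and i: "i < m"
  shows "block (m*d) i (kron (uncopy m) (1\<^sub>m d) *\<^sub>v v) = kron (perm_mat m (swp i)) (1\<^sub>m d) *\<^sub>v block (m*d) i v"
proof (rule eq_vecI)
  have dk: "dim_vec (kron (perm_mat m (swp i)) (1\<^sub>m d) *\<^sub>v x) = m * d" for x
    using kron_carrier[OF perm_mat_carrier one_carrier_mat, of m "swp i" d] by simp
  then show "dim_vec (block (m*d) i (kron (uncopy m) (1\<^sub>m d) *\<^sub>v v)) = dim_vec (kron (perm_mat m (swp i)) (1\<^sub>m d) *\<^sub>v block (m*d) i v)"
    by simp
  fix k assume "k < dim_vec (kron (perm_mat m (swp i)) (1\<^sub>m d) *\<^sub>v block (m*d) i v)"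
  then have "k < m * d" using dk by simp
  then obtain j l where jl: "j < m" "l < d" "k = j*d+l" by (rule less_mult_cases)
  have v': "dim_vec v = m * m * d" using v by (simp add: mult.assoc)
  have b: "dim_vec (block (m*d) i v) = m * d" by simp
  note s = swp_less[OF i jl(1)]
  have "block (m*d) i (kron (uncopy m) (1\<^sub>m d) *\<^sub>v v) $ k = (kron (uncopy m) (1\<^sub>m d) *\<^sub>v v) $ ((i*m+j)*d+l)"
    using jl mult_add_less[OF jl(1,2)] by (simp add: algebra_simps)
  also have "\<dots> = (uncopy m *\<^sub>v slice d l v) $ (i*m+j)"
    using kron_one_right_index[OF uncopy_carrier v' mult_add_less[OF i jl(1)] jl(2)] .
  also have "\<dots> = slice d l v $ (i*m + swp i j)"
    using uncopy_mult_vec[OF dim_slice[OF v' jl(2)] i jl(1)] .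
  also have "\<dots> = v $ ((i*m + swp i j)*d+l)"
    using slice_index[OF v' jl(2) mult_add_less[OF i s]] .
  also have "\<dots> = block (m*d) i v $ (swp i j * d + l)"
    using mult_add_less[OF s jl(2)] by (simp add: algebra_simps)
  also have "\<dots> = slice d l (block (m*d) i v) $ swp i j"
    using slice_index[OF b jl(2) s] by simp
  also have "\<dots> = (perm_mat m (swp i) *\<^sub>v slice d l (block (m*d) i v)) $ j"
    using perm_mat_mult_vec[where s="swp i", OF dim_slice[OF b jl(2)] jl(1) s] by simp
  also have "\<dots> = (kron (perm_mat m (swp i)) (1\<^sub>m d) *\<^sub>v block (m*d) i v) $ k"
    using kron_one_right_index[OF perm_mat_carrier b jl(1,2)] jl(3) by simp
  finally show "block (m*d) i (kron (uncopy m) (1\<^sub>m d) *\<^sub>v v) $ k = (kron (perm_mat m (swp i)) (1\<^sub>m d) *\<^sub>v block (m*d) i v) $ k" .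
qed

text \<open>Here \<open>p a\<close> is the distribution of the basis state sent for choice bit
  \<open>a\<close>, \<open>w\<close> that of Bob's hidden coin, and \<open>ph\<close> gives his
  phases. The assumption \<open>orth\<close> is perfect decodability: the states for different
  values of the chosen bit are orthogonal for all pairs of coin values, since Alice does not know
  the coin.\<close>

locale phase_protocol =
  fixes m n :: nat and p :: "bool \<Rightarrow> nat \<Rightarrow> real" and w :: "nat \<Rightarrow> real"
    and ph :: "bool \<Rightarrow> bool \<Rightarrow> nat \<Rightarrow> nat \<Rightarrow> complex"
  assumes p_nonneg: "p a i \<ge> 0" and p_sum: "(\<Sum>i<m. p a i) = 1"
    and w_nonneg: "w t \<ge> 0" and w_sum: "(\<Sum>t<n. w t) = 1"
    and norm_ph: "cmod (ph x0 x1 t i) = 1"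
    and orth: "sel a x0 x1 \<noteq> sel a y0 y1 \<Longrightarrow> t < n \<Longrightarrow> t' < n \<Longrightarrow>
      (\<Sum>i<m. of_real (p a i) * cnj (ph x0 x1 t i) * ph y0 y1 t' i) = 0"
begin

text \<open>Alice keeps a copy of the basis state that she sends. The message alone is therefore a
  classical mixture with weights \<open>p a i\<close>, which is all that Bob can learn from.\<close>

definition copied :: "bool \<Rightarrow> complex vec" where
  "copied a = vec (m*m) (\<lambda>k. if k div m = k mod m then of_real (sqrt (p a (k div m))) else 0)"

text \<open>Bob's random choice, purified because the model starts him in a pure state. The register
  only controls phases and stays with Bob, so in Alice's statistics it acts as a classical
  coin.\<close>

definition coin :: "complex vec" where
  "coin = vec n (\<lambda>t. of_real (sqrt (w t)))"

definition phases :: "bool \<Rightarrow> bool \<Rightarrow> complex mat" where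
  "phases x0 x1 = diag_phase (m*n) (\<lambda>k. ph x0 x1 (k mod n) (k div n))"

definition received :: "bool \<Rightarrow> bool \<Rightarrow> bool \<Rightarrow> nat \<Rightarrow> complex vec" where
  "received a x0 x1 t = vec m (\<lambda>i. ph x0 x1 t i * of_real (sqrt (p a i)))"

lemma cinner_received:
  "cinner (received a x0 x1 t) (received a y0 y1 t') = (\<Sum>i<m. of_real (p a i) * cnj (ph x0 x1 t i) * ph y0 y1 t' i)"
proof -
  have "complex_of_real (sqrt (p a i)) * complex_of_real (sqrt (p a i)) = of_real (p a i)" for i
    using p_nonneg[of a i] by (metis of_real_mult real_sqrt_mult_self abs_of_nonneg)
  then have "cnj (ph x0 x1 t i * of_real (sqrt (p a i))) * (ph y0 y1 t' i * of_real (sqrt (p a i)))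
     = of_real (p a i) * cnj (ph x0 x1 t i) * ph y0 y1 t' i" for i
    by (metis (no_types, lifting) complex_cnj_complex_of_real complex_cnj_mult mult.commute mult.left_commute)
  then show ?thesis
    unfolding cinner_def by (intro sum.cong) (auto simp: received_def)
qed

lemma cnj_ph_mult: "cnj (ph x0 x1 t i) * ph x0 x1 t i = 1"
  using norm_ph[of x0 x1 t i] complex_norm_square[of "ph x0 x1 t i"] by (simp add: mult.commute)

text \<open>The projector onto the span of all states whose chosen bit is True works: by
  \<open>orth\<close> the other states are orthogonal to that span. One projector serves all coin
  values and all values of the other bit.\<close>

lemma exists_decoder:
  "\<exists>Q. projector_on m Q \<and> (\<forall>x0 x1. \<forall>t<n. Q *\<^sub>v received a x0 x1 t = (if sel a x0 x1 then received a x0 x1 t else 0\<^sub>v m))"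
proof -
  define vs where "vs = map (\<lambda>(x0,x1,t). received a x0 x1 t) 
    (filter (\<lambda>(x0,x1,t). sel a x0 x1) (List.product [False,True] (List.product [False,True] [0..<n])))"
  have vs: "v \<in> set vs \<longleftrightarrow> (\<exists>x0 x1 t. t < n \<and> sel a x0 x1 \<and> v = received a x0 x1 t)" for v
  proof -
    have B: "set [False, True] = UNIV" by auto
    have "set vs = (\<lambda>(x0,x1,t). received a x0 x1 t) ` {(x0,x1,t). sel a x0 x1 \<and> t < n}"
      unfolding vs_def set_map set_filter set_product B set_upt
      by (rule arg_cong[where f="image _"]) auto
    then show ?thesis by (auto simp: image_iff)
  qed
  have "\<And>v. v \<in> set vs \<Longrightarrow> dim_vec v = m" by (auto simp: vs received_def)
  from exists_projector_onto[OF this] obtain Q where Q: "projector_on m Q" "\<forall>v\<in>set vs. Q *\<^sub>v v = v"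
    "\<And>u. dim_vec u = m \<Longrightarrow> (\<forall>v\<in>set vs. cinner v u = 0) \<Longrightarrow> Q *\<^sub>v u = 0\<^sub>v m" by metis
  have "Q *\<^sub>v received a x0 x1 t = (if sel a x0 x1 then received a x0 x1 t else 0\<^sub>v m)" if t: "t < n" for x0 x1 t
  proof (cases "sel a x0 x1")
    case True
    then have "received a x0 x1 t \<in> set vs" using vs t by blast
    then show ?thesis using Q(2) True by simp
  next
    case False
    have "\<forall>v\<in>set vs. cinner v (received a x0 x1 t) = 0"
      using False t by (auto simp: vs cinner_received intro!: orth)
    then show ?thesis using Q(3)[of "received a x0 x1 t"] False by (simp add: received_def)
  qed
  then show ?thesis using Q(1) by blast
qed

definition decoder :: "bool \<Rightarrow> complex mat" where
  "decoder a = (SOME Q. projector_on m Q \<and> 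
    (\<forall>x0 x1. \<forall>t<n. Q *\<^sub>v received a x0 x1 t = (if sel a x0 x1 then received a x0 x1 t else 0\<^sub>v m)))"

lemma decoder:
  shows "projector_on m (decoder a)"
    and "t < n \<Longrightarrow> decoder a *\<^sub>v received a x0 x1 t = (if sel a x0 x1 then received a x0 x1 t else 0\<^sub>v m)"
  using someI_ex[OF exists_decoder[of a]] unfolding decoder_def[symmetric] by auto

text \<open>Honest Alice never aborts, so the two proper answers already sum to the identity. Bob's
  success probability then loses its dependence on her answer.\<close>

definition decode :: "bool \<Rightarrow> bool option \<Rightarrow> complex mat" where
  "decode a k = (case k of None \<Rightarrow> 0\<^sub>m m m | Some v \<Rightarrow> if v then decoder a else 1\<^sub>m m - decoder a)"

lemma decode_carrier: "decode a k \<in> carrier_mat m m"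
  using decoder(1)[of a] by (auto simp: decode_def projector_on_def split: option.split)

lemma UNIV_bool_option: "(UNIV :: bool option set) = {None, Some False, Some True}"
  by (auto simp: UNIV_option_conv UNIV_bool)

lemma povm_decode: "povm_on m (decode a)"
  unfolding povm_on_def
proof (intro conjI allI impI)
  fix k show "psd_on m (decode a k)"
    using projector_psd[OF decoder(1)] psd_zero by (auto simp: decode_def split: option.split)
next
  fix i j assume "i < m" "j < m"
  moreover have "decoder a \<in> carrier_mat m m" using decoder(1)[of a] by (simp add: projector_on_def)
  ultimately show "(\<Sum>k\<in>UNIV. decode a k $$ (i,j)) = (if i = j then 1 else 0)"
    by (auto simp: decode_def UNIV_bool_option)
qed

definition protocol :: ot_protocol where
  "protocol = \<lparr> dA = m, dM = m, dB = n, rounds = 1,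
     aInit = copied, aUnit = \<lambda>_ _. uncopy m, aMeas = decode,
     bInit = \<lambda>_ _. coin, bUnit = \<lambda>_. phases, bMeas = \<lambda>_ _. accept (m*n) \<rparr>"

lemma dim_coin [simp]: "dim_vec coin = n"
  by (simp add: coin_def)

lemma dim_copied [simp]: "dim_vec (copied a) = m * m"
  by (simp add: copied_def)

lemma unit_coin: "unit_state n coin"
proof -
  have "cinner coin coin = of_real (\<Sum>t<n. w t)"
    unfolding cinner_self coin_def using w_nonneg by (simp add: norm_of_real)
  then show ?thesis using w_sum by (simp add: unit_state_def)
qed

lemma block_copied: "i < m \<Longrightarrow> block m i (copied a) = of_real (sqrt (p a i)) \<cdot>\<^sub>v unit_vec m i"
  by (intro eq_vecI) (auto simp: copied_def mult_add_less mult_add_div)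

lemma cinner_unit_vec: "i < k \<Longrightarrow> cinner (unit_vec k i) (unit_vec k i) = 1"
proof -
  assume i: "i < k"
  have "cinner (unit_vec k i) (unit_vec k i) = (\<Sum>j<k. if j = i then 1 else 0)"
    using i unfolding cinner_def by (intro sum.cong) auto
  then show ?thesis using i by simp
qed

lemma unit_copied: "unit_state (m*m) (copied a)"
proof -
  have "cinner (copied a) (copied a) = (\<Sum>i<m. of_real (p a i))"
    unfolding cinner_block[OF dim_copied]
  proof (intro sum.cong refl)
    fix i assume "i \<in> {..<m}"
    then have i: "i < m" by simp
    have "complex_of_real (sqrt (p a i)) * complex_of_real (sqrt (p a i)) = of_real (p a i)"
      using p_nonneg[of a i] by (metis of_real_mult real_sqrt_mult_self abs_of_nonneg)
    then show "cinner (block m i (copied a)) (block m i (copied a)) = of_real (p a i)"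
      unfolding block_copied[OF i] using cinner_unit_vec[OF i] by (simp add: cinner_smult_left cinner_smult_right)
  qed
  also have "\<dots> = of_real (\<Sum>i<m. p a i)" by simp
  finally show ?thesis using p_sum by (simp add: unit_state_def)
qed

lemma unitary_phases: "unitary_on (m*n) (phases x0 x1)"
  unfolding phases_def by (rule unitary_diag_phase) (rule norm_ph)

lemma phases_carrier: "phases x0 x1 \<in> carrier_mat (m*n) (m*n)"
  by (simp add: phases_def)

text \<open>Fixing the coin value commutes with everything Alice does, and Bob's unitary becomes
  multiplication by the phases of that value. The coin survives only as the amplitude
  \<open>sqrt (w t)\<close>.\<close>

lemma run_slice:
  fixes x0 x1
  assumes psi: "dim_vec psi = d * m" and U: "U 0 \<in> carrier_mat (d*m) (d*m)"
  defines "run \<equiv> exec d m n psi coin U (\<lambda>_. phases x0 x1) 1"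
  shows "dim_vec run = d * m * n"
    and "t < n \<Longrightarrow> slice n t run = of_real (sqrt (w t)) \<cdot>\<^sub>v (U 0 *\<^sub>v modulate m (ph x0 x1 t) psi)"
proof -
  define v where "v = kron (1\<^sub>m d) (phases x0 x1) *\<^sub>v vkron psi coin"
  have run: "run = kron (U 0) (1\<^sub>m n) *\<^sub>v v" by (simp add: run_def v_def)
  show "dim_vec run = d * m * n" using kron_carrier[OF U one_carrier_mat, of n] by (simp add: run)
  have dv: "dim_vec v = d * m * n"
    using kron_carrier[OF one_carrier_mat phases_carrier, of d] by (auto simp: v_def mult.assoc)
  assume t: "t < n"
  have "slice n t v = of_real (sqrt (w t)) \<cdot>\<^sub>v modulate m (ph x0 x1 t) psi"
  proof (rule eq_vecI)
    show "dim_vec (slice n t v) = dim_vec (of_real (sqrt (w t)) \<cdot>\<^sub>v modulate m (ph x0 x1 t) psi)"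
      using dim_slice[OF dv t] psi by simp
    fix k assume "k < dim_vec (of_real (sqrt (w t)) \<cdot>\<^sub>v modulate m (ph x0 x1 t) psi)"
    then have k: "k < d * m" using psi by simp
    then obtain j i where ji: "j < d" "i < m" "k = j*m+i" by (rule less_mult_cases)
    note it = mult_add_less[OF ji(2) t]
    have dk: "dim_vec (vkron psi coin) = d * (m * n)" using psi by (simp add: mult.assoc)
    have "slice n t v $ k = v $ (k*n+t)" by (rule slice_index[OF dv t k])
    also have "\<dots> = block (m*n) j v $ (i*n+t)"
      using it ji by (simp add: algebra_simps)
    also have "\<dots> = (phases x0 x1 *\<^sub>v block (m*n) j (vkron psi coin)) $ (i*n+t)"
      unfolding v_def block_kron[OF phases_carrier dk ji(1)] ..
    also have "\<dots> = ph x0 x1 t i * block (m*n) j (vkron psi coin) $ (i*n+t)"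
      unfolding phases_def using diag_phase_mult_vec[OF dim_block it] t by (simp add: mult_add_div)
    also have "block (m*n) j (vkron psi coin) $ (i*n+t) = vkron psi coin $ (k*n+t)"
      using it ji by (simp add: algebra_simps)
    also have "\<dots> = psi $ k * of_real (sqrt (w t))"
      using vkron_index[of k psi t coin] k t psi by (simp add: coin_def)
    finally show "slice n t v $ k = (of_real (sqrt (w t)) \<cdot>\<^sub>v modulate m (ph x0 x1 t) psi) $ k"
      using k psi ji by (simp add: modulate_def mult_ac)
  qed
  then have "slice n t run = U 0 *\<^sub>v (of_real (sqrt (w t)) \<cdot>\<^sub>v modulate m (ph x0 x1 t) psi)"
    unfolding run slice_kron[OF U dv t] by simp
  also have "\<dots> = of_real (sqrt (w t)) \<cdot>\<^sub>v (U 0 *\<^sub>v modulate m (ph x0 x1 t) psi)"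
    using U psi by (intro mult_mat_vec) (auto intro: carrier_vecI)
  finally show "slice n t run = of_real (sqrt (w t)) \<cdot>\<^sub>v (U 0 *\<^sub>v modulate m (ph x0 x1 t) psi)" .
qed

lemma jprob_run:
  fixes G :: "'o::finite \<Rightarrow> complex mat"
  assumes psi: "dim_vec psi = d * m" and U: "U 0 \<in> carrier_mat (d*m) (d*m)" and G: "\<And>g. G g \<in> carrier_mat d d"
  shows "jprob (exec d m n psi coin U (\<lambda>_. phases x0 x1) 1) G (accept (m*n)) R
    = (\<Sum>t<n. w t * (\<Sum>g | R g True. prob (U 0 *\<^sub>v modulate m (ph x0 x1 t) psi) (kron (G g) (1\<^sub>m m))))"
proof -
  let ?run = "exec d m n psi coin U (\<lambda>_. phases x0 x1) 1"
  note r = run_slice[where U=U and d=d and psi=psi and ?x0.0=x0 and ?x1.0=x1, OF psi U]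
  have 1: "prob ?run (kron (G g) (1\<^sub>m (m*n))) = (\<Sum>t<n. w t * prob (U 0 *\<^sub>v modulate m (ph x0 x1 t) psi) (kron (G g) (1\<^sub>m m)))" for g
    unfolding prob_kron_one_mult[OF G r(1)]
  proof (intro sum.cong refl)
    fix t assume "t \<in> {..<n}"
    then have t: "t < n" by simp
    have "prob (of_real (sqrt (w t)) \<cdot>\<^sub>v (U 0 *\<^sub>v modulate m (ph x0 x1 t) psi)) (kron (G g) (1\<^sub>m m))
      = (cmod (of_real (sqrt (w t))))\<^sup>2 * prob (U 0 *\<^sub>v modulate m (ph x0 x1 t) psi) (kron (G g) (1\<^sub>m m))"
      using U by (intro prob_smult[OF kron_carrier[OF G one_carrier_mat]]) simp
    then show "prob (slice n t ?run) (kron (G g) (1\<^sub>m m)) = w t * prob (U 0 *\<^sub>v modulate m (ph x0 x1 t) psi) (kron (G g) (1\<^sub>m m))"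
      using w_nonneg[of t] r(2)[OF t] by (simp add: norm_of_real)
  qed
  have "dim_vec ?run = d * (m * n)" using r(1) by (simp add: mult.assoc)
  from jprob_accept[OF G this] 
  have "jprob ?run G (accept (m*n)) R = (\<Sum>g | R g True. prob ?run (kron (G g) (1\<^sub>m (m*n))))" .
  also have "\<dots> = (\<Sum>t<n. \<Sum>g | R g True. w t * prob (U 0 *\<^sub>v modulate m (ph x0 x1 t) psi) (kron (G g) (1\<^sub>m m)))"
    unfolding 1 by (rule sum.swap)
  finally show ?thesis by (simp add: sum_distrib_left)
qed

lemma exec_protocol:
  "honest_run protocol a x0 x1 = exec m m n (copied a) coin (\<lambda>_. uncopy m) (\<lambda>_. phases x0 x1) 1"
  "alice_run protocol d psi U x0 x1 = exec d m n psi coin U (\<lambda>_. phases x0 x1) 1"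
  by (simp_all add: honest_run_def alice_run_def protocol_def)

text \<open>Message and copy agree, so Bob's phase may be read as a phase on Alice's copy. Resetting
  the message to 0 disentangles it and leaves \<open>received\<close> in her register.\<close>

lemma prob_uncopied:
  assumes E: "E \<in> carrier_mat m m"
  shows "prob (uncopy m *\<^sub>v modulate m (ph x0 x1 t) (copied a)) (kron E (1\<^sub>m m)) = prob (received a x0 x1 t) E"
proof -
  let ?v = "uncopy m *\<^sub>v modulate m (ph x0 x1 t) (copied a)"
  have dv: "dim_vec ?v = m * m" by (simp add: uncopy_def perm_mat_def)
  have slice_v: "slice m j ?v = (if j = 0 then received a x0 x1 t else 0\<^sub>v m)" if j: "j < m" for j
  proof (rule eq_vecI)
    show "dim_vec (slice m j ?v) = dim_vec (if j = 0 then received a x0 x1 t else 0\<^sub>v m)"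
      using dim_slice[OF dv j] by (simp add: received_def)
    fix i assume "i < dim_vec (if j = 0 then received a x0 x1 t else 0\<^sub>v m)"
    then have i: "i < m" by (auto simp: received_def split: if_splits)
    note s = swp_less[OF i j] and less = mult_add_less[OF i swp_less[OF i j]]
    have "slice m j ?v $ i = ?v $ (i*m+j)" by (rule slice_index[OF dv j i])
    also have "\<dots> = modulate m (ph x0 x1 t) (copied a) $ (i*m + swp i j)"
      by (rule uncopy_mult_vec[OF _ i j]) simp
    also have "\<dots> = ph x0 x1 t (swp i j) * (if i = swp i j then of_real (sqrt (p a i)) else 0)"
      using less s by (simp add: modulate_def copied_def mult_add_div)
    also have "\<dots> = (if j = 0 then received a x0 x1 t else 0\<^sub>v m) $ i"
      using i swp_eq_iff[of i j] by (auto simp: received_def)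
    finally show "slice m j ?v $ i = (if j = 0 then received a x0 x1 t else 0\<^sub>v m) $ i" .
  qed
  have z: "prob (0\<^sub>v m) E = 0" using E by (simp add: prob_def cinner_def)
  have m: "0 < m" using p_sum[of a] by (cases m) auto
  have "prob ?v (kron E (1\<^sub>m m)) = (\<Sum>j<m. prob (slice m j ?v) E)"
    by (rule prob_kron_one_right[OF E dv])
  also have "\<dots> = (\<Sum>j<m. if j = 0 then prob (received a x0 x1 t) E else 0)"
    using slice_v z by (intro sum.cong) auto
  finally show ?thesis using m by simp
qed

lemma prob_decode:
  assumes "t < n"
  shows "prob (received a x0 x1 t) (decode a (Some (sel a x0 x1))) = 1"
proof -
  let ?r = "received a x0 x1 t"
  have dr: "dim_vec ?r = m" by (simp add: received_def)
  have Q: "decoder a \<in> carrier_mat m m" using decoder(1)[of a] by (simp add: projector_on_def)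
  have "decode a (Some (sel a x0 x1)) *\<^sub>v ?r = ?r"
  proof (cases "sel a x0 x1")
    case True
    then show ?thesis using decoder(2)[OF assms, of a x0 x1] by (simp add: decode_def)
  next
    case False
    have "(1\<^sub>m m - decoder a) *\<^sub>v ?r = 1\<^sub>m m *\<^sub>v ?r - decoder a *\<^sub>v ?r"
      using Q dr by (intro minus_mult_distrib_mat_vec[of _ m m]) (auto intro: carrier_vecI)
    also have "1\<^sub>m m *\<^sub>v ?r = ?r" using dr by (metis carrier_vecI one_mult_mat_vec)
    also have "decoder a *\<^sub>v ?r = 0\<^sub>v m" using decoder(2)[OF assms, of a x0 x1] False by simp
    also have "?r - 0\<^sub>v m = ?r" using dr by (intro eq_vecI) auto
    finally show ?thesis using False by (simp add: decode_def)
  qed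
  moreover have "cinner ?r ?r = 1"
  proof -
    have "cinner ?r ?r = (\<Sum>i<m. of_real (p a i))"
      unfolding cinner_received by (intro sum.cong refl) (simp add: cnj_ph_mult mult.assoc)
    also have "\<dots> = of_real (\<Sum>i<m. p a i)" by simp
    finally show ?thesis using p_sum by simp
  qed
  ultimately show ?thesis by (simp add: prob_def)
qed

lemma honest_jprob:
  fixes R :: "bool option \<Rightarrow> bool \<Rightarrow> bool"
  shows "jprob (honest_run protocol a x0 x1) (decode a) (accept (m*n)) R
    = (\<Sum>t<n. w t * (\<Sum>g | R g True. prob (received a x0 x1 t) (decode a g)))"
  unfolding exec_protocol prob_uncopied[OF decode_carrier, symmetric]
  by (rule jprob_run) (simp_all add: decode_carrier)

lemma valid_protocol: "valid_ot_protocol protocol"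
proof -
  have "jprob (honest_run protocol a x0 x1) (decode a) (accept (m*n)) (\<lambda>k r. k = Some (sel a x0 x1) \<and> r) = 1" for a x0 x1
    unfolding honest_jprob by (simp add: prob_decode w_sum)
  then show ?thesis
    using unit_copied unitary_uncopy povm_decode unit_coin unitary_phases povm_accept
    unfolding valid_ot_protocol_def by (simp add: protocol_def)
qed

section \<open>Security against a cheating Bob\<close>

lemma bob_cheat_prob_le:
  assumes ok: "cheat_bob_ok protocol d phi V F"
  shows "bob_cheat_prob protocol d phi V F \<le> (1/2) * (\<Sum>i<m. max (p False i) (p True i))"
proof -
  have phi: "dim_vec phi = d" "cinner phi phi = 1" and V: "unitary_on (m*d) (V 0)" and F: "povm_on (m*d) F"
    using ok by (auto simp: cheat_bob_ok_def unit_state_def protocol_def)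
  have Vc: "V 0 \<in> carrier_mat (m*d) (m*d)" using V by (simp add: unitary_on_def)
  define fin where "fin a = exec m m d (copied a) phi (\<lambda>_. uncopy m) V 1" for a
  define S where "S i = kron (perm_mat m (swp i)) (1\<^sub>m d)" for i
  \<comment> \<open>Bob's normalised final state given that Alice's register holds \<open>i\<close>.
    Her choice bit does not occur in it.\<close>
  define \<xi> where "\<xi> i = S i *\<^sub>v (V 0 *\<^sub>v vkron (unit_vec m i) phi)" for i
  have Sc: "S i \<in> carrier_mat (m*d) (m*d)" for i
    unfolding S_def by (rule kron_carrier) simp_all
  have fin: "fin a = kron (uncopy m) (1\<^sub>m d) *\<^sub>v (kron (1\<^sub>m m) (V 0) *\<^sub>v vkron (copied a) phi)" for a
    by (simp add: fin_def)
  have dk: "dim_vec (kron (1\<^sub>m m) (V 0) *\<^sub>v v) = m * (m * d)" for v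
    using kron_carrier[OF one_carrier_mat Vc, of m] by auto
  have dfin: "dim_vec (fin a) = m * (m * d)" for a
    using kron_carrier[OF uncopy_carrier one_carrier_mat, of m d] by (simp add: fin mult.assoc)
  have block_fin: "block (m*d) i (fin a) = of_real (sqrt (p a i)) \<cdot>\<^sub>v \<xi> i" if i: "i < m" for a i
  proof -
    have dc: "dim_vec (vkron (copied a) phi) = m * (m * d)" using phi by (simp add: mult.assoc)
    have "block (m*d) i (fin a) = S i *\<^sub>v (V 0 *\<^sub>v block (m*d) i (vkron (copied a) phi))"
      unfolding fin S_def block_kron_uncopy[OF dk i] block_kron[OF Vc dc i] ..
    also have "block (m*d) i (vkron (copied a) phi) = of_real (sqrt (p a i)) \<cdot>\<^sub>v vkron (unit_vec m i) phi"
      unfolding block_vkron[OF dim_copied phi(1) i] block_copied[OF i] vkron_smult_left ..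
    also have "V 0 *\<^sub>v \<dots> = of_real (sqrt (p a i)) \<cdot>\<^sub>v (V 0 *\<^sub>v vkron (unit_vec m i) phi)"
      using Vc phi by (intro mult_mat_vec) (auto intro: carrier_vecI)
    also have "S i *\<^sub>v \<dots> = of_real (sqrt (p a i)) \<cdot>\<^sub>v (S i *\<^sub>v (V 0 *\<^sub>v vkron (unit_vec m i) phi))"
      using Vc Sc[of i] by (intro mult_mat_vec) (auto intro: carrier_vecI)
    finally show ?thesis by (simp only: \<xi>_def)
  qed
  have d\<xi>: "dim_vec (\<xi> i) = m * d" for i using Sc[of i] by (auto simp: \<xi>_def)
  have n\<xi>: "cinner (\<xi> i) (\<xi> i) = 1" if i: "i < m" for i
  proof -
    have u: "unitary_on m (perm_mat m (swp i))"
      using swp_less[OF i] swp_swp by (intro unitary_perm_mat) auto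
    have "dim_vec (V 0 *\<^sub>v vkron (unit_vec m i) phi) = m * d" using Vc by auto
    then have "cinner (\<xi> i) (\<xi> i) = cinner (V 0 *\<^sub>v vkron (unit_vec m i) phi) (V 0 *\<^sub>v vkron (unit_vec m i) phi)"
      unfolding \<xi>_def S_def using cinner_kron_unitary[OF u] by blast
    also have "\<dots> = cinner (vkron (unit_vec m i) phi) (vkron (unit_vec m i) phi)"
      using phi by (intro cinner_unitary[OF V]) auto
    also have "\<dots> = 1"
      using cinner_vkron[of "unit_vec m i" m "unit_vec m i" phi d phi] phi cinner_unit_vec[OF i] by simp
    finally show ?thesis .
  qed
  have jp: "jprob (fin a) (decode a) F (\<lambda>k g. k \<noteq> None \<and> g = a) = (\<Sum>i<m. p a i * prob (\<xi> i) (F a))" for a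
  proof -
    have Fc: "F a \<in> carrier_mat (m*d) (m*d)" using povm_onD(2)[OF F] .
    have Q: "decoder a \<in> carrier_mat m m" using decoder(1)[of a] by (simp add: projector_on_def)
    have "jprob (fin a) (decode a) F (\<lambda>k g. k \<noteq> None \<and> g = a) = (\<Sum>b\<in>UNIV. prob (fin a) (kron (decode a (Some b)) (F a)))"
    proof -
      have "(\<Sum>r\<in>UNIV. if k \<noteq> None \<and> r = a then prob (fin a) (kron (decode a k) (F r)) else 0)
          = (if k = None then 0 else prob (fin a) (kron (decode a k) (F a)))" for k
        by (cases k) simp_all
      then show ?thesis
        unfolding jprob_def UNIV_bool_option by (simp add: UNIV_bool add.commute)
    qed
    \<comment> \<open>The answers other than abort sum to the identity, so Alice's outcome can be
      summed away.\<close>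
    also have "\<dots> = prob (fin a) (kron (1\<^sub>m m) (F a))"
    proof (rule prob_sum_mat[symmetric])
      show "kron (decode a (Some b)) (F a) \<in> carrier_mat (m*(m*d)) (m*(m*d))" for b
        by (rule kron_carrier[OF decode_carrier Fc])
      show "kron (1\<^sub>m m) (F a) \<in> carrier_mat (m*(m*d)) (m*(m*d))"
        by (rule kron_carrier[OF one_carrier_mat Fc])
      show "dim_vec (fin a) = m*(m*d)" by (rule dfin)
      fix k l assume "k < m*(m*d)" "l < m*(m*d)"
      then show "kron (1\<^sub>m m) (F a) $$ (k,l) = (\<Sum>b\<in>UNIV. kron (decode a (Some b)) (F a) $$ (k,l))"
        using Q Fc by (auto simp: kron_def decode_def UNIV_bool div_less_mult algebra_simps)
    qed
    also have "\<dots> = (\<Sum>i<m. prob (block (m*d) i (fin a)) (F a))"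
      by (rule prob_kron_one_left[OF Fc dfin])
    also have "\<dots> = (\<Sum>i<m. p a i * prob (\<xi> i) (F a))"
    proof (intro sum.cong refl)
      fix i assume "i \<in> {..<m}"
      then have i: "i < m" by simp
      show "prob (block (m*d) i (fin a)) (F a) = p a i * prob (\<xi> i) (F a)"
        unfolding block_fin[OF i] prob_smult[OF Fc d\<xi>] using p_nonneg[of a i] by (simp add: norm_of_real)
    qed
    finally show ?thesis .
  qed
  have "bob_cheat_prob protocol d phi V F = (1/2) * (\<Sum>a\<in>UNIV. jprob (fin a) (decode a) F (\<lambda>k g. k \<noteq> None \<and> g = a))"
    by (simp add: bob_cheat_prob_def protocol_def fin_def)
  also have "(\<Sum>a\<in>UNIV. jprob (fin a) (decode a) F (\<lambda>k g. k \<noteq> None \<and> g = a)) 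
      = (\<Sum>i<m. p False i * prob (\<xi> i) (F False) + p True i * prob (\<xi> i) (F True))"
    unfolding jp by (simp add: UNIV_bool sum.distrib)
  \<comment> \<open>What remains is guessing a bit from the classical datum \<open>i\<close>, where
    the more likely value is the best guess.\<close>
  also have "\<dots> \<le> (\<Sum>i<m. max (p False i) (p True i))"
  proof (rule sum_mono)
    fix i assume "i \<in> {..<m}"
    then have i: "i < m" by simp
    have nn: "prob (\<xi> i) (F b) \<ge> 0" for b using prob_nonneg[OF povm_onD(1)[OF F] d\<xi>] .
    have s: "prob (\<xi> i) (F False) + prob (\<xi> i) (F True) = 1"
      using prob_povm_sum[OF F d\<xi>[of i]] n\<xi>[OF i] by (simp add: UNIV_bool add.commute)
    have "p False i * prob (\<xi> i) (F False) + p True i * prob (\<xi> i) (F True)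
      \<le> max (p False i) (p True i) * prob (\<xi> i) (F False) + max (p False i) (p True i) * prob (\<xi> i) (F True)"
      using nn by (intro add_mono mult_right_mono) auto
    also have "\<dots> = max (p False i) (p True i) * (prob (\<xi> i) (F False) + prob (\<xi> i) (F True))"
      by (simp only: distrib_left)
    finally show "p False i * prob (\<xi> i) (F False) + p True i * prob (\<xi> i) (F True) \<le> max (p False i) (p True i)"
      unfolding s by simp
  qed
  finally show ?thesis by simp
qed

lemma P_Bob_star_le: "P_Bob_star protocol \<le> (1/2) * (\<Sum>i<m. max (p False i) (p True i))"
  unfolding P_Bob_star_def
proof (rule cSup_least)
  \<comment> \<open>A trivial cheater of dimension 1 shows that the supremum is over a nonempty
    set.\<close>
  have "unit_state 1 (unit_vec 1 0)" using cinner_unit_vec[of 0 1] by (simp add: unit_state_def)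
  moreover have "unitary_on k (1\<^sub>m k)" for k by (simp add: unitary_on_def)
  ultimately have "cheat_bob_ok protocol 1 (unit_vec 1 0) (\<lambda>_. 1\<^sub>m (m*1)) (accept (m*1))"
    unfolding cheat_bob_ok_def using povm_accept by (simp add: protocol_def)
  then show "{bob_cheat_prob protocol d phi V F |d phi V F. cheat_bob_ok protocol d phi V F} \<noteq> {}" by blast
next
  fix x assume "x \<in> {bob_cheat_prob protocol d phi V F |d phi V F. cheat_bob_ok protocol d phi V F}"
  then show "x \<le> (1/2) * (\<Sum>i<m. max (p False i) (p True i))" using bob_cheat_prob_le by blast
qed

section \<open>What certainty forces on a cheating Alice\<close>

lemma cheat_alice_okD:
  assumes "cheat_alice_ok protocol d psi U G"
  shows "dim_vec psi = d * m" "cinner psi psi = 1" "unitary_on (d*m) (U 0)" "U 0 \<in> carrier_mat (d*m) (d*m)" "povm_on d G"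
    "G g \<in> carrier_mat d d"
  using assms povm_onD(2) by (auto simp: cheat_alice_ok_def unit_state_def protocol_def unitary_on_def)

lemma sum_weight:
  assumes "dim_vec psi = d * m" "cinner psi psi = 1"
  shows "(\<Sum>i<m. weight m psi i) = 1"
proof -
  have "modulate m (\<lambda>_. 1) psi = psi" by (intro eq_vecI) (auto simp: modulate_def)
  then have "cinner psi psi = of_real (\<Sum>i<m. weight m psi i)"
    using cinner_modulate[OF assms(1), of "\<lambda>_. 1" "\<lambda>_. 1"] by simp
  then show ?thesis using assms(2) by (metis of_real_eq_1_iff)
qed

lemma cinner_modulate_ph:
  assumes "dim_vec psi = d * m" "cinner psi psi = 1"
  shows "cinner (modulate m (ph x0 x1 t) psi) (modulate m (ph x0 x1 t) psi) = 1"
proof -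
  have "cinner (modulate m (ph x0 x1 t) psi) (modulate m (ph x0 x1 t) psi) = of_real (\<Sum>i<m. weight m psi i)"
    unfolding cinner_modulate[OF assms(1)] by (simp add: cnj_ph_mult mult.assoc)
  then show ?thesis using sum_weight[OF assms] by simp
qed

lemma alice_jprob:
  assumes "cheat_alice_ok protocol d psi U G"
  shows "jprob (alice_run protocol d psi U x0 x1) G (bMeas protocol x0 x1) R
    = (\<Sum>t<n. w t * (\<Sum>g | R g True. prob (U 0 *\<^sub>v modulate m (ph x0 x1 t) psi) (kron (G g) (1\<^sub>m m))))"
proof -
  note D = cheat_alice_okD[OF assms]
  have b: "bMeas protocol x0 x1 = accept (m*n)" by (simp add: protocol_def)
  show ?thesis unfolding b exec_protocol by (rule jprob_run) (rule D)+
qed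

lemma alice_povm_sum:
  assumes ok: "cheat_alice_ok protocol d psi U G"
  shows "(\<Sum>g\<in>UNIV. prob (U 0 *\<^sub>v modulate m (ph x0 x1 t) psi) (kron (G g) (1\<^sub>m m))) = 1"
proof -
  note D = cheat_alice_okD[OF ok]
  have "dim_vec (U 0 *\<^sub>v modulate m (ph x0 x1 t) psi) = d * m" using D(4) by auto
  from prob_povm_sum[OF povm_kron_one[OF D(5)] this] show ?thesis
    using cinner_unitary[OF D(3)] cinner_modulate_ph[OF D(1,2)] D(1) by simp
qed

text \<open>An average of probabilities equals 1 only if every branch of positive weight is
  error-free. The size of that weight does not matter, which is why a rarely used branch still
  constrains Alice exactly.\<close>

lemma alice_wrong_guess:
  assumes ok: "cheat_alice_ok protocol d psi U G" and cert: "alice_certain protocol c d psi U G"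
    and t: "t < n" "w t > 0"
  shows "(\<Sum>g | sel c (fst g) (snd g) \<noteq> sel c x0 x1. prob (U 0 *\<^sub>v modulate m (ph x0 x1 t) psi) (kron (G g) (1\<^sub>m m))) = 0"
proof -
  note D = cheat_alice_okD[OF ok]
  let ?y = "\<lambda>t. U 0 *\<^sub>v modulate m (ph x0 x1 t) psi"
  let ?good = "\<lambda>t. \<Sum>g | sel c (fst g) (snd g) = sel c x0 x1. prob (?y t) (kron (G g) (1\<^sub>m m))"
  let ?bad = "\<lambda>t. \<Sum>g | sel c (fst g) (snd g) \<noteq> sel c x0 x1. prob (?y t) (kron (G g) (1\<^sub>m m))"
  have dy: "dim_vec (?y t) = d * m" for t using D(4) by auto
  have nn: "prob (?y t) (kron (G g) (1\<^sub>m m)) \<ge> 0" for g t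
    using prob_nonneg[OF povm_onD(1)[OF povm_kron_one[OF D(5)]] dy] .
  have gb: "?good t + ?bad t = 1" for t
  proof -
    have "?good t + ?bad t = (\<Sum>g\<in>{g. sel c (fst g) (snd g) = sel c x0 x1} \<union> {g. sel c (fst g) (snd g) \<noteq> sel c x0 x1}. 
        prob (?y t) (kron (G g) (1\<^sub>m m)))"
      by (subst sum.union_disjoint) auto
    also have "{g. sel c (fst g) (snd g) = sel c x0 x1} \<union> {g. sel c (fst g) (snd g) \<noteq> sel c x0 x1} = UNIV" by auto
    finally show ?thesis using alice_povm_sum[OF ok] by simp
  qed
  have "(\<Sum>t<n. w t * ?good t) = 1"
    using cert unfolding alice_certain_def alice_jprob[OF ok] by simp
  moreover have "(\<Sum>t<n. w t * ?good t) + (\<Sum>t<n. w t * ?bad t) = 1"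
  proof -
    have "(\<Sum>t<n. w t * ?good t) + (\<Sum>t<n. w t * ?bad t) = (\<Sum>t<n. w t * (?good t + ?bad t))"
      by (simp only: sum.distrib distrib_left)
    then show ?thesis unfolding gb using w_sum by simp
  qed
  ultimately have "(\<Sum>t<n. w t * ?bad t) = 0" by simp
  moreover have "w t * ?bad t \<ge> 0" for t using w_nonneg nn by (intro mult_nonneg_nonneg sum_nonneg)
  ultimately have "w t * ?bad t = 0" using t(1) by (simp add: sum_nonneg_eq_0_iff)
  then show ?thesis using t(2) by simp
qed

text \<open>Error-free answers make the final states orthogonal, Alice's unitary preserves overlaps,
  and the phases are diagonal. The result is the relation \<open>orth\<close> with the honest
  weights \<open>p a\<close> replaced by those of her message, whatever the rest of her
  strategy.\<close>

lemma alice_certain_orth: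
  assumes ok: "cheat_alice_ok protocol d psi U G" and cert: "alice_certain protocol c d psi U G"
    and t: "t < n" "w t > 0" and t': "t' < n" "w t' > 0" and ne: "sel c x0 x1 \<noteq> sel c y0 y1"
  shows "(\<Sum>i<m. of_real (weight m psi i) * cnj (ph x0 x1 t i) * ph y0 y1 t' i) = 0"
proof -
  note D = cheat_alice_okD[OF ok]
  let ?y = "\<lambda>x0 x1 t. U 0 *\<^sub>v modulate m (ph x0 x1 t) psi"
  let ?S = "{g :: bool \<times> bool. sel c (fst g) (snd g) \<noteq> sel c x0 x1}"
  have dy: "dim_vec (?y x0 x1 t) = d * m" for x0 x1 t using D(4) by auto
  have S: "- ?S = {g. sel c (fst g) (snd g) \<noteq> sel c y0 y1}" using ne by auto
  have "cinner (?y x0 x1 t) (?y y0 y1 t') = 0"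
  proof (rule povm_orthogonal[where S="?S", OF povm_kron_one[OF D(5)] dy dy])
    show "(\<Sum>g\<in>?S. prob (?y x0 x1 t) (kron (G g) (1\<^sub>m m))) = 0"
      by (rule alice_wrong_guess[OF ok cert t])
    show "(\<Sum>g\<in>-?S. prob (?y y0 y1 t') (kron (G g) (1\<^sub>m m))) = 0"
      unfolding S by (rule alice_wrong_guess[OF ok cert t'])
  qed
  then show ?thesis
    using cinner_unitary[OF D(3)] D(1) by (simp add: cinner_modulate[OF D(1)])
qed

lemma alice_cheat_prob_eq:
  assumes ok: "cheat_alice_ok protocol d psi U G"
  shows "alice_cheat_prob protocol c d psi U G = (1/4) * (\<Sum>x0\<in>UNIV. \<Sum>x1\<in>UNIV. \<Sum>t<n. w t * 
    (\<Sum>g | sel (\<not> c) (fst g) (snd g) = sel (\<not> c) x0 x1. prob (U 0 *\<^sub>v modulate m (ph x0 x1 t) psi) (kron (G g) (1\<^sub>m m))))"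
  unfolding alice_cheat_prob_def alice_jprob[OF ok] by simp

text \<open>Each supremum in \<open>P_Alice_star\<close> must range over a nonempty set. The witness
  is honest Alice, who adds the constant guess False for the other bit.\<close>

lemma exists_certain_alice:
  "\<exists>d psi U G. cheat_alice_ok protocol d psi U G \<and> alice_certain protocol c d psi U G"
proof -
  define G where "G g = (if sel (\<not> c) (fst g) (snd g) then 0\<^sub>m m m else decode c (Some (sel c (fst g) (snd g))))" for g :: "bool \<times> bool"
  have U2: "(UNIV :: (bool \<times> bool) set) = {(False,False),(False,True),(True,False),(True,True)}"
    by (auto simp: UNIV_bool)
  have Gc: "G g \<in> carrier_mat m m" for g by (simp add: G_def decode_carrier)
  have Q: "decoder c \<in> carrier_mat m m" using decoder(1)[of c] by (simp add: projector_on_def)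
  have "povm_on m G"
    unfolding povm_on_def
  proof (intro conjI allI impI)
    fix g show "psd_on m (G g)" using povm_onD(1)[OF povm_decode] psd_zero by (simp add: G_def)
  next
    fix i j assume "i < m" "j < m"
    then show "(\<Sum>g\<in>UNIV. G g $$ (i,j)) = (if i = j then 1 else 0)"
      using Q by (cases c) (auto simp: U2 G_def sel_def decode_def)
  qed
  then have ok: "cheat_alice_ok protocol m (copied c) (\<lambda>_. uncopy m) G"
    using unit_copied unitary_uncopy by (simp add: cheat_alice_ok_def protocol_def)
  have "alice_certain protocol c m (copied c) (\<lambda>_. uncopy m) G"
    unfolding alice_certain_def alice_jprob[OF ok] prob_uncopied[OF Gc]
  proof (intro allI)
    fix x0 x1
    have z: "prob (received c x0 x1 t) (0\<^sub>m m m) = 0" for t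
      by (simp add: prob_def received_def cinner_mult_mat[of _ m m])
    have "(\<Sum>g | sel c (fst g) (snd g) = sel c x0 x1. prob (received c x0 x1 t) (G g))
      = prob (received c x0 x1 t) (decode c (Some (sel c x0 x1)))" for t
    proof -
      have "{g. sel c (fst g) (snd g) = sel c x0 x1} 
        = (\<lambda>b. if c then (b, sel c x0 x1) else (sel c x0 x1, b)) ` {False, True}"
        by (cases c) (auto simp: sel_def)
      then show ?thesis using z by (cases c) (auto simp: G_def sel_def)
    qed
    then show "(\<Sum>t<n. w t * (\<Sum>g | sel c (fst g) (snd g) = sel c x0 x1. prob (received c x0 x1 t) (G g))) = 1"
      using w_sum by (simp add: prob_decode)
  qed
  then show ?thesis using ok by blast
qed

lemma P_Alice_star_le:
  assumes "\<And>c d psi U G. cheat_alice_ok protocol d psi U G \<Longrightarrow> alice_certain protocol c d psi U G \<Longrightarrow>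
    alice_cheat_prob protocol c d psi U G \<le> r"
  shows "P_Alice_star protocol \<le> r"
  unfolding P_Alice_star_def
proof (subst Max_le_iff)
  have "Sup {alice_cheat_prob protocol c d psi U G | d psi U G.
      cheat_alice_ok protocol d psi U G \<and> alice_certain protocol c d psi U G} \<le> r" for c
    using exists_certain_alice[of c] assms[of _ _ _ _ c] by (intro cSup_least) auto
  then show "\<forall>x\<in>range (\<lambda>c. Sup {alice_cheat_prob protocol c d psi U G | d psi U G.
      cheat_alice_ok protocol d psi U G \<and> alice_certain protocol c d psi U G}). x \<le> r" by auto
qed auto

end

section \<open>The protocol\<close>

definition sg :: "bool \<Rightarrow> complex" where
  "sg b = (if b then - 1 else 1)"

text \<open>The message basis is indexed by \<open>i = 4 s + \<tau>\<close> with a symbol \<open>s < 7\<close> and \<open>\<tau> < 4\<close>. The symbols 0, 1, 2 form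
  the qutrit block; on the symbols 3 to 6 the phases are the four characters of \<open>(x\<^sub>0, x\<^sub>1)\<close>, so that an
  equal superposition of them reveals both bits.\<close>

definition bits_phase :: "bool \<Rightarrow> bool \<Rightarrow> nat \<Rightarrow> complex" where
  "bits_phase x0 x1 s = (if s = 0 \<or> s = 4 then sg x0 else if s = 1 \<or> s = 5 then sg x1 
     else if s = 6 then sg x0 * sg x1 else 1)"

lemma cmod_bits_phase: "cmod (bits_phase x0 x1 s) = 1"
  by (simp add: bits_phase_def sg_def norm_mult)

lemma lessThan_numerals:
  "{..<3} = {0,1,2::nat}" "{..<4} = {0,1,2,3::nat}" "{..<7} = {0,1,2,3,4,5,6::nat}"
  by auto

lemma sum_weight_eq_0:
  assumes "weight m v i = 0" "k < dim_vec v" "k mod m = i" "dim_vec v = d * m"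
  shows "v $ k = 0"
proof -
  have m: "m > 0" using assms by (cases m) auto
  have "(\<Sum>j<d. (cmod (v $ (j*m+i)))\<^sup>2) = 0" using assms(1,4) m by (simp add: weight_def)
  moreover have "k div m < d" using assms(2,4) by (simp add: div_less_mult)
  ultimately have "(cmod (v $ (k div m * m + i)))\<^sup>2 = 0" by (simp add: sum_nonneg_eq_0_iff)
  then show ?thesis using assms(3) div_mult_mod_eq[of k m] by simp
qed

locale enforced_protocol =
  fixes q \<eta> :: real
  assumes q: "0 \<le> q" "q \<le> 1" and eta: "0 < \<eta>" "\<eta> < 1"
begin

text \<open>Symbol 2 always has phase 1 in the normal branches up to sign of the revealing block; it
  is the reference against which the sign on symbol 0 or 1 is read. The four equally weighted
  symbols from 3 on turn the two bits into four orthogonal states.\<close>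

definition prior :: "bool \<Rightarrow> nat \<Rightarrow> real" where
  "prior a s = (if s = 2 \<or> s = (if a then 1 else 0) then (1-q)/2 else if 3 \<le> s then q/4 else 0)"

text \<open>Only the real parts \<open>q\<close> and \<open>q - 1\<close> matter against a cheating Alice: they make \<open>\<Sum>s. W s * probe s = 0\<close>
  force weight \<open>q\<close> on the symbols 3 to 6. The imaginary parts give modulus 1 and cancel for honest Alice.\<close>

definition probe :: "nat \<Rightarrow> complex" where
  "probe s = (if s < 3 then Complex q (if s = 2 then - sqrt (1 - q\<^sup>2) else sqrt (1 - q\<^sup>2))
     else Complex (q - 1) (if s < 5 then sqrt (1 - (q-1)\<^sup>2) else - sqrt (1 - (q-1)\<^sup>2)))"

text \<open>Bob's hidden coin \<open>t\<close> is 0 or 1 in the normal branches, which differ in the sign of the revealing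
  block, and 2 in the branch that enforces the weights.\<close>

definition body :: "bool \<Rightarrow> bool \<Rightarrow> nat \<Rightarrow> nat \<Rightarrow> complex" where
  "body x0 x1 t s = (if t = 2 then if x0 then probe s else 1
     else if t = 1 \<and> 3 \<le> s then - bits_phase x0 x1 s else bits_phase x0 x1 s)"

text \<open>Orthogonal characters in \<open>\<tau>\<close> tell Alice whether \<open>t = 2\<close> and, if so, the parity of Bob's bits. Given the parity,
  the probe on \<open>x\<^sub>0\<close> alone conveys both bits, so honest Alice needs no further information.\<close>

definition tag :: "bool \<Rightarrow> bool \<Rightarrow> nat \<Rightarrow> nat \<Rightarrow> complex" where
  "tag x0 x1 t \<tau> = (if t = 2 then if x0 = x1 then (- 1) ^ \<tau> else (- 1) ^ (\<tau> div 2) else 1)"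

definition phase :: "bool \<Rightarrow> bool \<Rightarrow> nat \<Rightarrow> nat \<Rightarrow> complex" where
  "phase x0 x1 t i = body x0 x1 t (i div 4) * tag x0 x1 t (i mod 4)"

definition coin_weight :: "nat \<Rightarrow> real" where
  "coin_weight t = (if t = 2 then \<eta> else (1 - \<eta>)/2)"

lemma cmod_probe: "cmod (probe s) = 1"
proof -
  have "q\<^sup>2 \<le> 1" "(q-1)\<^sup>2 \<le> 1" using q by (auto simp: abs_square_le_1)
  then show ?thesis by (simp add: probe_def cmod_def)
qed

lemma cmod_phase: "cmod (phase x0 x1 t i) = 1"
  by (simp add: phase_def body_def tag_def norm_mult norm_power cmod_probe cmod_bits_phase)

lemma sum_28: "(\<Sum>i<28. f i) = (\<Sum>s<7. \<Sum>\<tau><4. f (s*4+\<tau>))" for f :: "nat \<Rightarrow> 'a::comm_monoid_add"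
  using sum_lessThan_mult[of f 7 4] by simp

lemma sum_28_div: "(\<Sum>i<28. f (i div 4)) = 4 * (\<Sum>s<7. f s)" for f :: "nat \<Rightarrow> 'a::comm_semiring_1"
proof -
  have "(\<Sum>i<28. f (i div 4)) = (\<Sum>s<7. \<Sum>\<tau><4::nat. f s)"
    unfolding sum_28 by (intro sum.cong refl) (simp add: mult_add_div)
  then show ?thesis by (simp add: sum_distrib_left)
qed

lemma sum_7: "(\<Sum>s<7. f s) = f 0 + f 1 + f 2 + (f 3 + f 4 + f 5 + f (6::nat))" for f :: "nat \<Rightarrow> 'a::comm_monoid_add"
  unfolding lessThan_numerals by (simp add: add_ac)

section \<open>Completeness: the orthogonality relations for honest Alice\<close>

lemma body_orth:
  assumes ne: "sel a x0 x1 \<noteq> sel a y0 y1"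
    and t: "t < 2 \<and> t' < 2 \<or> t = 2 \<and> t' = 2 \<and> (x0 = x1) = (y0 = y1)"
  shows "(\<Sum>s<7. of_real (prior a s) * cnj (body x0 x1 t s) * body y0 y1 t' s) = 0"
  using t
proof
  assume t: "t < 2 \<and> t' < 2"
  define c where "c = (if t = 1 then - 1 else 1 :: complex) * (if t' = 1 then - 1 else 1)"
  define F where "F s = of_real (prior a s) * cnj (body x0 x1 t s) * body y0 y1 t' s" for s
  define G where "G s = of_real (prior a s) * cnj (bits_phase x0 x1 s) * bits_phase y0 y1 s" for s
  have F: "s < 3 \<Longrightarrow> F s = G s" "3 \<le> s \<Longrightarrow> F s = c * G s" for s
    using t by (auto simp: F_def G_def body_def c_def)
  \<comment> \<open>Each block vanishes by itself: the first because the reference symbol and the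
    chosen one have equal weight and opposite relative sign, the second by orthogonality of the
    characters. So the unknown relative sign \<open>c\<close> does no harm.\<close>
  have "G 0 + G 1 + G 2 = 0 \<and> G 3 + G 4 + G 5 + G 6 = 0"
    using ne unfolding G_def
    by (cases a; cases x0; cases x1; cases y0; cases y1)
      (simp_all add: sel_def prior_def bits_phase_def sg_def)
  moreover have "(\<Sum>s<7. F s) = (G 0 + G 1 + G 2) + c * (G 3 + G 4 + G 5 + G 6)"
    unfolding sum_7 by (simp add: F distrib_left)
  ultimately show ?thesis by (simp add: F_def)
next
  assume t: "t = 2 \<and> t' = 2 \<and> (x0 = x1) = (y0 = y1)"
  \<comment> \<open>With equal parity the bits differ together, so \<open>probe\<close> appears on
    exactly one side. Its real part sums to (1 - q) * q + q * (q - 1) = 0, and its imaginary parts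
    cancel in pairs of equal weight.\<close>
  then have "x0 \<noteq> y0" using ne by (auto simp: sel_def split: if_splits)
  then show ?thesis
    using t unfolding sum_7
    by (cases a; cases x0) (simp_all add: prior_def body_def probe_def complex_eq_iff field_simps)
qed

lemma tag_orth:
  assumes "t = 2 \<and> t' < 2 \<or> t < 2 \<and> t' = 2 \<or> t = 2 \<and> t' = 2 \<and> (x0 = x1) \<noteq> (y0 = y1)"
  shows "(\<Sum>\<tau><4. cnj (tag x0 x1 t \<tau>) * tag y0 y1 t' \<tau>) = 0"
  using assms unfolding lessThan_numerals by (auto simp: tag_def)

lemma phase_orth:
  assumes "sel a x0 x1 \<noteq> sel a y0 y1" "t < 3" "t' < 3"
  shows "(\<Sum>i<28. of_real (prior a (i div 4) / 4) * cnj (phase x0 x1 t i) * phase y0 y1 t' i) = 0"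
proof -
  have "(\<Sum>i<28. of_real (prior a (i div 4) / 4) * cnj (phase x0 x1 t i) * phase y0 y1 t' i)
    = (\<Sum>s<7. \<Sum>\<tau><4. (of_real (prior a s) * cnj (body x0 x1 t s) * body y0 y1 t' s) * (cnj (tag x0 x1 t \<tau>) * tag y0 y1 t' \<tau> / 4))"
    unfolding sum_28 by (intro sum.cong refl) (simp add: phase_def mult_add_div)
  also have "\<dots> = (\<Sum>s<7. of_real (prior a s) * cnj (body x0 x1 t s) * body y0 y1 t' s) * 
      ((\<Sum>\<tau><4. cnj (tag x0 x1 t \<tau>) * tag y0 y1 t' \<tau>) / 4)"
    by (simp only: sum_product sum_divide_distrib)
  also have "\<dots> = 0"
  proof (cases "t < 2 \<and> t' < 2 \<or> t = 2 \<and> t' = 2 \<and> (x0 = x1) = (y0 = y1)")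
    case True
    then show ?thesis using body_orth[OF assms(1)] by simp
  next
    case False
    moreover have "t < 2 \<or> t = 2" "t' < 2 \<or> t' = 2" using assms(2,3) by auto
    ultimately have "t = 2 \<and> t' < 2 \<or> t < 2 \<and> t' = 2 \<or> t = 2 \<and> t' = 2 \<and> (x0 = x1) \<noteq> (y0 = y1)"
      by blast
    then show ?thesis using tag_orth by simp
  qed
  finally show ?thesis .
qed

text \<open>The 28 basis states are 7 symbols times 4 tag values, with the weight of a symbol spread
  evenly over its tags, as orthogonality of the tags requires. There are 3 coin values.\<close>

sublocale phase_protocol 28 3 "\<lambda>a i. prior a (i div 4) / 4" coin_weight phase
proof
  fix a i show "0 \<le> prior a (i div 4) / 4" using q by (simp add: prior_def)
next
  fix a
  have "(\<Sum>i<28. prior a (i div 4) / 4) = 4 * (\<Sum>s<7. prior a s / 4)" by (rule sum_28_div)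
  also have "\<dots> = 1" unfolding lessThan_numerals by (cases a) (simp_all add: prior_def field_simps)
  finally show "(\<Sum>i<28. prior a (i div 4) / 4) = 1" .
next
  fix t show "0 \<le> coin_weight t" using eta by (simp add: coin_weight_def)
next
  show "(\<Sum>t<3. coin_weight t) = 1" unfolding lessThan_numerals by (simp add: coin_weight_def)
next
  fix x0 x1 t i show "cmod (phase x0 x1 t i) = 1" by (rule cmod_phase)
qed (rule phase_orth)

text \<open>Symbols 0 and 1 each occur for only one choice bit; all others are equally likely under
  both. The maxima sum to 3 * (1 - q)/2 + q.\<close>

lemma bob_bound: "P_Bob_star protocol \<le> (3 - q) / 4"
proof -
  have "(\<Sum>i<28. max (prior False (i div 4) / 4) (prior True (i div 4) / 4))
     = 4 * (\<Sum>s<7. max (prior False s / 4) (prior True s / 4))" by (rule sum_28_div)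
  also have "\<dots> = (3 - q) / 2"
    unfolding lessThan_numerals using q by (simp add: prior_def field_simps)
  finally show ?thesis using P_Bob_star_le by simp
qed

lemma probe_Re: "Re (probe s) = (if s < 3 then q else q - 1)"
  by (simp add: probe_def)

section \<open>A fixed cheating Alice who learns one bit with certainty\<close>

context
  fixes c d psi U G
  assumes ok: "cheat_alice_ok protocol d psi U G" and cert: "alice_certain protocol c d psi U G"
begin

definition symbol_weight :: "nat \<Rightarrow> real" where
  "symbol_weight s = (\<Sum>\<tau><4. weight 28 psi (s*4+\<tau>))"

lemma psi: "dim_vec psi = d * 28" "cinner psi psi = 1"
  using cheat_alice_okD[OF ok] by auto

lemma sum_symbol_weight: "(\<Sum>s<7. symbol_weight s) = 1"
  using sum_weight[OF psi] by (simp add: sum_28 symbol_weight_def)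

lemma sum_weight_div: "(\<Sum>i<28. of_real (weight 28 psi i) * f (i div 4)) = (\<Sum>s<7. of_real (symbol_weight s) * f s)"
  for f :: "nat \<Rightarrow> complex"
  unfolding sum_28 symbol_weight_def by (simp add: mult_add_div sum_distrib_right)

lemma symbol_orth:
  assumes ne: "sel c x0 x1 \<noteq> sel c y0 y1" 
    and t: "t < 2 \<and> t' < 2 \<or> t = 2 \<and> t' = 2 \<and> (x0 = x1) = (y0 = y1)"
  shows "(\<Sum>s<7. of_real (symbol_weight s) * (cnj (body x0 x1 t s) * body y0 y1 t' s)) = 0"
proof -
  have w: "coin_weight u > 0" for u using eta by (simp add: coin_weight_def)
  have tag: "cnj (tag x0 x1 t \<tau>) * tag y0 y1 t' \<tau> = 1" for \<tau>
    using t by (auto simp: tag_def power_mult_distrib[symmetric])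
  have "cnj (phase x0 x1 t i) * phase y0 y1 t' i = cnj (body x0 x1 t (i div 4)) * body y0 y1 t' (i div 4)" for i
  proof -
    have "cnj (phase x0 x1 t i) * phase y0 y1 t' i = (cnj (body x0 x1 t (i div 4)) * body y0 y1 t' (i div 4)) 
        * (cnj (tag x0 x1 t (i mod 4)) * tag y0 y1 t' (i mod 4))"
      by (simp add: phase_def)
    then show ?thesis unfolding tag by simp
  qed
  moreover have "t < 3" "t' < 3" using t by auto
  ultimately have "(\<Sum>i<28. of_real (weight 28 psi i) * (cnj (body x0 x1 t (i div 4)) * body y0 y1 t' (i div 4))) = 0"
    using alice_certain_orth[OF ok cert _ w _ w ne, of t t'] by (simp add: mult.assoc)
  then show ?thesis
    using sum_weight_div[of "\<lambda>s. cnj (body x0 x1 t s) * body y0 y1 t' s"] by simp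
qed

text \<open>This is the symbol carrying the other bit. Adding the relations for coin values 0 and 1
  isolates the qutrit block; there the weight of this symbol enters with a sign that depends on
  whether the other bit changes too. Both signs give a vanishing sum, so the weight is 0.\<close>

lemma idle_symbol: "symbol_weight (if c then 0 else 1) = 0"
proof -
  have e: "symbol_weight (if c then 0 else 1) = 0" if "\<not> c" 
  proof -
    have "(\<Sum>s<7. of_real (symbol_weight s) * (cnj (body False False t s) * body True b t' s)) = 0" if "t < 2" "t' < 2" for b t t'
      using symbol_orth[of False False True b t t'] that \<open>\<not> c\<close> by (simp add: sel_def)
    from this[of 0 0 False] this[of 0 1 False] this[of 0 0 True] this[of 0 1 True] 
    show ?thesis using \<open>\<not> c\<close> unfolding sum_7 by (simp add: body_def bits_phase_def sg_def complex_eq_iff)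
  qed
  have e': "symbol_weight (if c then 0 else 1) = 0" if c
  proof -
    have "(\<Sum>s<7. of_real (symbol_weight s) * (cnj (body False False t s) * body b True t' s)) = 0" if "t < 2" "t' < 2" for b t t'
      using symbol_orth[of False False b True t t'] that \<open>c\<close> by (simp add: sel_def)
    from this[of 0 0 False] this[of 0 1 False] this[of 0 0 True] this[of 0 1 True] 
    show ?thesis using \<open>c\<close> unfolding sum_7 by (simp add: body_def bits_phase_def sg_def complex_eq_iff)
  qed
  show ?thesis using e e' by (cases c) auto
qed

lemma reveal_weight: "symbol_weight 3 + symbol_weight 4 + symbol_weight 5 + symbol_weight 6 = q"
proof -
  \<comment> \<open>This pair of inputs differs in both bits and has equal parity, so it serves both
    values of \<open>c\<close>; one side has trivial phases, leaving \<open>probe\<close>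
    alone.\<close>
  have "(\<Sum>s<7. of_real (symbol_weight s) * (cnj (body False False 2 s) * body True True 2 s)) = 0"
    by (rule symbol_orth) (simp_all add: sel_def)
  then have "(\<Sum>s<7. of_real (symbol_weight s) * probe s) = 0" by (simp add: body_def)
  from arg_cong[OF this, of Re] have "(\<Sum>s<7. symbol_weight s * Re (probe s)) = 0" by simp
  then have "(symbol_weight 0 + symbol_weight 1 + symbol_weight 2) * q 
      + (symbol_weight 3 + symbol_weight 4 + symbol_weight 5 + symbol_weight 6) * (q - 1) = 0"
    unfolding sum_7 probe_Re by (simp add: algebra_simps)
  moreover have "symbol_weight 0 + symbol_weight 1 + symbol_weight 2
      = 1 - (symbol_weight 3 + symbol_weight 4 + symbol_weight 5 + symbol_weight 6)"
    using sum_symbol_weight unfolding sum_7 by simp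
  \<comment> \<open>With R for the revealing weight the left side is q - R: the real parts
    \<open>q\<close> and \<open>q - 1\<close> were chosen to differ by 1.\<close>
  ultimately have "(1 - (symbol_weight 3 + symbol_weight 4 + symbol_weight 5 + symbol_weight 6)) * q 
      + (symbol_weight 3 + symbol_weight 4 + symbol_weight 5 + symbol_weight 6) * (q - 1) = 0"
    by simp
  then show ?thesis by (simp add: algebra_simps)
qed

text \<open>The probability of an answer in \<open>S\<close> if \<open>v\<close> is what Bob
  returns. Unnormalised \<open>v\<close> are allowed, so that the two blocks of a state can be
  scored separately.\<close>

definition gain :: "(bool \<times> bool) set \<Rightarrow> complex vec \<Rightarrow> real" where
  "gain S v = (\<Sum>g\<in>S. prob (U 0 *\<^sub>v v) (kron (G g) (1\<^sub>m 28)))"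

lemma dim_U: "dim_vec (U 0 *\<^sub>v v) = d * 28"
  using cheat_alice_okD(4)[OF ok] by auto

lemma gain_povm: "povm_on (d * 28) (\<lambda>g. kron (G g) (1\<^sub>m 28))"
  by (rule povm_kron_one[OF cheat_alice_okD(5)[OF ok]])

lemma gain_UNIV: "dim_vec v = d * 28 \<Longrightarrow> gain UNIV v = Re (cinner v v)"
  unfolding gain_def prob_povm_sum[OF gain_povm dim_U]
  using cinner_unitary[OF cheat_alice_okD(3)[OF ok]] by simp

lemma gain_le: "dim_vec v = d * 28 \<Longrightarrow> gain S v \<le> Re (cinner v v)"
  unfolding gain_UNIV[symmetric] unfolding gain_def
  by (rule sum_mono2) (auto intro: prob_nonneg[OF povm_onD(1)[OF gain_povm] dim_U])

lemma gain_parallelogram: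
  assumes u: "dim_vec u = d * 28" and v: "dim_vec v = d * 28"
  shows "gain S (u + v) + gain S (u - v) = 2 * gain S u + 2 * gain S v"
proof -
  note Uc = cheat_alice_okD(4)[OF ok]
  have "U 0 *\<^sub>v (u + v) = U 0 *\<^sub>v u + U 0 *\<^sub>v v"
    using Uc u v by (intro mult_add_distrib_mat_vec[of _ "d * 28" "d * 28"]) (auto intro: carrier_vecI)
  moreover have "U 0 *\<^sub>v (u - v) = U 0 *\<^sub>v u - U 0 *\<^sub>v v"
    using Uc u v by (intro mult_minus_distrib_mat_vec[of _ "d * 28" "d * 28"]) (auto intro: carrier_vecI)
  ultimately show ?thesis
    unfolding gain_def sum_distrib_left sum.distrib[symmetric]
    using prob_parallelogram[OF povm_onD(2)[OF gain_povm] dim_U dim_U] by (intro sum.cong) auto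
qed

definition plain :: "bool \<Rightarrow> bool \<Rightarrow> complex vec" where
  "plain x0 x1 = modulate 28 (\<lambda>i. if i div 4 < 3 then bits_phase x0 x1 (i div 4) else 0) psi"

definition reveal :: "bool \<Rightarrow> bool \<Rightarrow> complex vec" where
  "reveal x0 x1 = modulate 28 (\<lambda>i. if i div 4 < 3 then 0 else bits_phase x0 x1 (i div 4)) psi"

lemma dim_plain [simp]: "dim_vec (plain x0 x1) = d * 28"
  and dim_reveal [simp]: "dim_vec (reveal x0 x1) = d * 28"
  using psi by (simp_all add: plain_def reveal_def)

lemma modulate_phase:
  "modulate 28 (phase x0 x1 0) psi = plain x0 x1 + reveal x0 x1"
  "modulate 28 (phase x0 x1 (Suc 0)) psi = plain x0 x1 - reveal x0 x1"
  by (intro eq_vecI; simp add: modulate_def plain_def reveal_def phase_def body_def tag_def)+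

lemma cnj_bits_phase_mult: "cnj (bits_phase x0 x1 s) * bits_phase x0 x1 s = 1"
  by (simp add: bits_phase_def sg_def)

lemma cinner_plain: "cinner (plain x0 x1) (plain x0 x1) = of_real (1 - q)"
proof -
  have "cinner (plain x0 x1) (plain x0 x1) = (\<Sum>i<28. of_real (weight 28 psi i) * (\<lambda>s. if s < 3 then 1 else 0) (i div 4))"
    unfolding plain_def cinner_modulate[OF psi(1)]
    by (intro sum.cong refl) (simp add: cnj_bits_phase_mult mult.assoc)
  also have "\<dots> = (\<Sum>s<7. of_real (symbol_weight s) * (\<lambda>s. if s < 3 then 1 else 0) s)"
    by (rule sum_weight_div)
  also have "\<dots> = of_real (symbol_weight 0 + symbol_weight 1 + symbol_weight 2)"
    unfolding sum_7 by simp
  also have "symbol_weight 0 + symbol_weight 1 + symbol_weight 2 = 1 - q"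
    using sum_symbol_weight reveal_weight unfolding sum_7 by simp
  finally show ?thesis .
qed

lemma cinner_reveal: "cinner (reveal x0 x1) (reveal x0 x1) = of_real q"
proof -
  have "cinner (reveal x0 x1) (reveal x0 x1) = (\<Sum>i<28. of_real (weight 28 psi i) * (\<lambda>s. if s < 3 then 0 else 1) (i div 4))"
    unfolding reveal_def cinner_modulate[OF psi(1)]
    by (intro sum.cong refl) (simp add: cnj_bits_phase_mult mult.assoc)
  also have "\<dots> = (\<Sum>s<7. of_real (symbol_weight s) * (\<lambda>s. if s < 3 then 0 else 1) s)"
    by (rule sum_weight_div)
  also have "\<dots> = of_real (symbol_weight 3 + symbol_weight 4 + symbol_weight 5 + symbol_weight 6)"
    unfolding sum_7 by simp
  finally show ?thesis unfolding reveal_weight .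
qed

text \<open>Within the qutrit block only the idle symbol carries the other bit, and Alice's state
  has no amplitude there.\<close>

lemma plain_cong:
  assumes "sel c x0 x1 = sel c y0 y1"
  shows "plain x0 x1 = plain y0 y1"
proof (rule eq_vecI)
  fix k assume "k < dim_vec (plain y0 y1)"
  then have k: "k < dim_vec psi" using psi by simp
  let ?i = "k mod 28"
  show "plain x0 x1 $ k = plain y0 y1 $ k"
  proof (cases "?i div 4 = (if c then 0 else 1)")
    case True
    have "(\<Sum>\<tau><4. weight 28 psi (?i div 4 * 4 + \<tau>)) = 0"
      using idle_symbol unfolding symbol_weight_def True .
    then have "\<forall>\<tau>\<in>{..<4}. weight 28 psi (?i div 4 * 4 + \<tau>) = 0"
      by (subst (asm) sum_nonneg_eq_0_iff) (auto simp: weight_nonneg)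
    then have "weight 28 psi (?i div 4 * 4 + ?i mod 4) = 0" by (rule bspec) simp
    then have "psi $ k = 0" using sum_weight_eq_0[of 28 psi ?i k d] k psi by simp
    then show ?thesis using k by (simp add: plain_def modulate_def)
  next
    case False
    then have "bits_phase x0 x1 (?i div 4) = bits_phase y0 y1 (?i div 4)" if "?i div 4 < 3"
      using assms that by (cases c) (auto simp: bits_phase_def sel_def)
    then show ?thesis using k by (simp add: plain_def modulate_def)
  qed
qed simp

definition hits :: "bool \<Rightarrow> bool \<Rightarrow> (bool \<times> bool) set" where
  "hits x0 x1 = {g. sel (\<not> c) (fst g) (snd g) = sel (\<not> c) x0 x1}"

text \<open>The two inputs yield the same vector but complementary sets of correct answers, so on
  average the qutrit block gives Alice a coin toss for the other bit.\<close>

lemma gain_plain_pair: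
  assumes "sel c x0 x1 = sel c y0 y1" "sel (\<not> c) x0 x1 \<noteq> sel (\<not> c) y0 y1"
  shows "gain (hits x0 x1) (plain x0 x1) + gain (hits y0 y1) (plain y0 y1) = 1 - q"
proof -
  have "hits x0 x1 \<inter> hits y0 y1 = {}" "hits x0 x1 \<union> hits y0 y1 = UNIV"
    using assms(2) by (auto simp: hits_def)
  then have "gain (hits x0 x1) (plain x0 x1) + gain (hits y0 y1) (plain x0 x1) = gain UNIV (plain x0 x1)"
    unfolding gain_def by (metis finite sum.union_disjoint)
  then show ?thesis using plain_cong[OF assms(1)] by (simp add: gain_UNIV cinner_plain)
qed

lemma alice_bound: "alice_cheat_prob protocol c d psi U G \<le> (1 - \<eta>) * ((1 + q) / 2) + \<eta>"
proof -
  let ?N = "\<lambda>x0 x1. gain (hits x0 x1) (plain x0 x1)"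
  have term_le: "(\<Sum>t<3. coin_weight t * gain (hits x0 x1) (modulate 28 (phase x0 x1 t) psi)) \<le> (1 - \<eta>) * (?N x0 x1 + q) + \<eta>" for x0 x1
  proof -
    \<comment> \<open>Coin values 0 and 1 are equally likely, so the interference between the two
      blocks averages out.\<close>
    have 1: "gain (hits x0 x1) (plain x0 x1 + reveal x0 x1) + gain (hits x0 x1) (plain x0 x1 - reveal x0 x1)
      = 2 * ?N x0 x1 + 2 * gain (hits x0 x1) (reveal x0 x1)"
      by (rule gain_parallelogram) simp_all
    have 2: "gain (hits x0 x1) (reveal x0 x1) \<le> q"
      using gain_le[of "reveal x0 x1" "hits x0 x1"] by (simp add: cinner_reveal)
    have 3: "gain (hits x0 x1) (modulate 28 (phase x0 x1 2) psi) \<le> 1"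
      using gain_le[of "modulate 28 (phase x0 x1 2) psi" "hits x0 x1"] psi(1)
      by (simp add: cinner_modulate_ph[OF psi])
    have "(\<Sum>t<3. coin_weight t * gain (hits x0 x1) (modulate 28 (phase x0 x1 t) psi))
      = (1 - \<eta>)/2 * (gain (hits x0 x1) (plain x0 x1 + reveal x0 x1) + gain (hits x0 x1) (plain x0 x1 - reveal x0 x1))
        + \<eta> * gain (hits x0 x1) (modulate 28 (phase x0 x1 2) psi)"
      unfolding lessThan_numerals by (simp add: coin_weight_def modulate_phase distrib_left)
    also have "\<dots> = (1 - \<eta>) * (?N x0 x1 + gain (hits x0 x1) (reveal x0 x1)) + \<eta> * gain (hits x0 x1) (modulate 28 (phase x0 x1 2) psi)"
      unfolding 1 by (simp add: field_simps)
    also have "\<dots> \<le> (1 - \<eta>) * (?N x0 x1 + q) + \<eta> * 1"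
      using 2 3 eta by (intro add_mono mult_left_mono) auto
    finally show ?thesis by simp
  qed
  \<comment> \<open>The four inputs form two pairs with a common known bit, each contributing
    \<open>1 - q\<close>.\<close>
  have pairs: "?N False False + ?N False True + ?N True False + ?N True True = 2 * (1 - q)"
  proof (cases c)
    case True
    then show ?thesis
      using gain_plain_pair[of False False True False] gain_plain_pair[of False True True True] by (simp add: sel_def)
  next
    case False
    then show ?thesis
      using gain_plain_pair[of False False False True] gain_plain_pair[of True False True True] by (simp add: sel_def)
  qed
  have "alice_cheat_prob protocol c d psi U G = (1/4) * (\<Sum>x0\<in>UNIV. \<Sum>x1\<in>UNIV.
      \<Sum>t<3. coin_weight t * gain (hits x0 x1) (modulate 28 (phase x0 x1 t) psi))"
    unfolding alice_cheat_prob_eq[OF ok] gain_def hits_def ..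
  also have "\<dots> \<le> (1/4) * (\<Sum>x0\<in>UNIV. \<Sum>x1\<in>UNIV. (1 - \<eta>) * (?N x0 x1 + q) + \<eta>)"
    by (intro mult_left_mono sum_mono term_le) simp
  also have "\<dots> = (1/4) * ((1 - \<eta>) * ((?N False False + ?N False True + ?N True False + ?N True True) + 4 * q) + 4 * \<eta>)"
    by (simp add: UNIV_bool algebra_simps)
  also have "\<dots> = (1 - \<eta>) * ((1 + q) / 2) + \<eta>"
    unfolding pairs by (simp add: field_simps)
  finally show ?thesis .
qed

end

lemma alice_star_bound: "P_Alice_star protocol \<le> (1 - \<eta>) * ((1 + q) / 2) + \<eta>"
  by (rule P_Alice_star_le) (rule alice_bound)

end

theorem theorem2:
  fixes a b \<epsilon> :: real
  assumes "1/2 \<le> a" "a \<le> 1" "1/2 \<le> b" "b \<le> 1" "2 * b + a = 2" "\<epsilon> > 0"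
  shows "\<exists>P. valid_ot_protocol P
           \<and> P_Alice_star P \<le> a + \<epsilon> / 2
           \<and> P_Bob_star P \<le> b + \<epsilon> / 4
           \<and> 2 * P_Bob_star P + P_Alice_star P \<le> 2 + \<epsilon>"
proof -
  \<comment> \<open>The cap 1/2 keeps the normal branches at positive probability even for large
    \<open>\<epsilon>\<close>.\<close>
  define \<eta> where "\<eta> = min (1/2) \<epsilon>"
  have h: "0 < \<eta>" "\<eta> < 1" "\<eta> \<le> \<epsilon>" using assms(6) by (auto simp: \<eta>_def)
  \<comment> \<open>This \<open>q\<close> solves (1 + q)/2 = a, and then (3 - q)/4 = 1 - a/2 =
    b.\<close>
  interpret enforced_protocol "2 * a - 1" \<eta>
    using assms(1,2) h by unfold_locales auto
  \<comment> \<open>Alice's bound equals a + \<open>\<eta> * (1 - a)\<close>, and 1 - a is at most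
    1/2.\<close>
  have "\<eta> * (1 - a) \<le> \<epsilon> * (1/2)"
    using assms(1,2) h by (intro mult_mono) auto
  then have A: "P_Alice_star protocol \<le> a + \<epsilon> / 2"
    using alice_star_bound by (simp add: algebra_simps)
  have B: "P_Bob_star protocol \<le> b"
    using bob_bound assms(5) by simp
  show ?thesis
    using valid_protocol A B assms(5,6) by (intro exI[of _ protocol]) auto
qed

end
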